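(* Let $n,p\in\mathbb{N}$ and let $L:\mathbb{R}[x]_{\leq 2n}\to \mathbb{S}_p(\mathbb{R})$ be a linear operator with moments $S_i:=L(x^i)$, $i=0,1,\ldots,2n$, such that its $n$-th truncated moment matrix $M(n)=(S_{i+j-2})_{i,j=1}^{n+1}$ is positive definite. Fix $t\in\mathbb{R}$. Then there exists a minimal representing measure $\mu$ for $L$ such that $\operatorname{mult}_\mu t=0$.
   Context: $\mathbb{N}=\{1,2,\ldots\}$. $\mathbb{R}[x]_{\leq k}$ is the real vector space of univariate polynomials of degree at most $k$. $\mathbb{S}_p(\mathbb{R})$ is the space of real symmetric $p\times p$ matrices. $M(n)$ is the $(n+1)\times(n+1)$ block matrix, with $p\times p$ blocks, whose $(i,j)$ block is $S_{i+j-2}$, regarded as a real $(n+1)p\times(n+1)p$ matrix. A positive $\mathbb{S}_p(\mathbb{R})$-valued measure is a map $\mu=(\mu_{ij})_{i,j=1}^p$ from the Borel $\sigma$-algebra of $\mathbb{R}$ to $\mathbb{S}_p(\mathbb{R})$ such that each $\mu_{ij}$ is a real (signed) measure and $\mu(\Delta)$ is positive semidefinite for every Borel set $\Delta$. Integrals are taken entrywise: $\int f\,d\mu=(\int f\,d\mu_{ij})_{i,j}$, where $f$ is required to be integrable with respect to the trace measure $\sum_i\mu_{ii}$. It is a representing measure for $L$ if $L(q)=\int_{\mathbb{R}} q\,d\mu$ for every $q\in\mathbb{R}[x]_{\leq 2n}$. A finitely atomic representing measure $\mu=\sum_{j=1}^{\ell}A_j\delta_{x_j}$ for $L$, where each $A_j\in\mathbb{S}_p(\mathbb{R})$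 is nonzero and positive semidefinite, the $x_j\in\mathbb{R}$ are pairwise distinct and $\delta_{x_j}$ is the Dirac measure at $x_j$, is called minimal if $\sum_{j=1}^{\ell}\operatorname{rank}A_j$ is minimal among all representing measures for $L$ of this form. The multiplicity of an atom is $\operatorname{mult}_\mu x_j:=\operatorname{rank}A_j=\operatorname{rank}\mu(\{x_j\})$, and $\operatorname{mult}_\mu x:=0$ if $x$ is not one of the atoms $x_j$. *)

theory Defs
  imports
    "HOL-Analysis.Analysis"
    "HOL-Computational_Algebra.Polynomial"
    "Jordan_Normal_Form.DL_Rank"
begin

definition sym_mats :: "nat \<Rightarrow> real mat set" where
  "sym_mats p = {A \<in> carrier_mat p p. transpose_mat A = A}"

definition pos_semidef :: "nat \<Rightarrow> real mat \<Rightarrow> bool" where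
  "pos_semidef p A \<longleftrightarrow> A \<in> sym_mats p \<and>
     (\<forall>v \<in> carrier_vec p. scalar_prod v (A *\<^sub>v v) \<ge> 0)"

definition pos_def :: "nat \<Rightarrow> real mat \<Rightarrow> bool" where
  "pos_def p A \<longleftrightarrow> A \<in> sym_mats p \<and>
     (\<forall>v \<in> carrier_vec p. v \<noteq> 0\<^sub>v p \<longrightarrow> scalar_prod v (A *\<^sub>v v) > 0)"

abbreviation mat_rank :: "nat \<Rightarrow> real mat \<Rightarrow> nat" where
  "mat_rank p A \<equiv> vec_space.rank p A"

(* A linear operator from the polynomials of degree at most d to the symmetric
   p x p matrices; the values of L at polynomials of larger degree are irrelevant. *)
definition sym_linear_operator :: "nat \<Rightarrow> nat \<Rightarrow> (real poly \<Rightarrow> real mat) \<Rightarrow> bool" where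
  "sym_linear_operator p d L \<longleftrightarrow>
     (\<forall>q. degree q \<le> d \<longrightarrow> L q \<in> sym_mats p) \<and>
     (\<forall>q r. degree q \<le> d \<longrightarrow> degree r \<le> d \<longrightarrow> L (q + r) = L q + L r) \<and>
     (\<forall>c q. degree q \<le> d \<longrightarrow> L (Polynomial.smult c q) = c \<cdot>\<^sub>m L q)"

definition moment :: "(real poly \<Rightarrow> real mat) \<Rightarrow> nat \<Rightarrow> real mat" where
  "moment L i = L (Polynomial.monom 1 i)"

(* With indices starting at 0, row a lies in block row a div p, at position a mod p
   inside the block, and the block in position (i, j) is the moment of index i + j. *)
definition moment_matrix :: "nat \<Rightarrow> nat \<Rightarrow> (real poly \<Rightarrow> real mat) \<Rightarrow> real mat" where
  "moment_matrix p n L = Matrix.mat ((n + 1) * p) ((n + 1) * p)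
     (\<lambda>(a, b). moment L (a div p + b div p) $$ (a mod p, b mod p))"

definition signed_measure :: "(real set \<Rightarrow> real) \<Rightarrow> bool" where
  "signed_measure \<nu> \<longleftrightarrow> \<nu> {} = 0 \<and>
     (\<forall>B :: nat \<Rightarrow> real set. range B \<subseteq> sets borel \<longrightarrow> disjoint_family B \<longrightarrow>
        (\<lambda>k. \<nu> (B k)) sums \<nu> (\<Union>k. B k))"

(* The positive part of the Jordan decomposition of a signed measure. The function
   ennreal sends negative reals to 0; this does not change the supremum, since the
   empty set is among the sets B and has measure 0. *)
definition upper_variation :: "(real set \<Rightarrow> real) \<Rightarrow> real measure" where
  "upper_variation \<nu> = measure_of UNIV (sets borel)
     (\<lambda>A. SUP B \<in> {B \<in> sets borel. B \<subseteq> A}. ennreal (\<nu> B))"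

(* The negative part of the Jordan decomposition is the positive part for the
   negated measure. *)
definition signed_integral :: "(real set \<Rightarrow> real) \<Rightarrow> (real \<Rightarrow> real) \<Rightarrow> real" where
  "signed_integral \<nu> f =
     (LINT x|upper_variation \<nu>. f x) - (LINT x|upper_variation (\<lambda>B. - \<nu> B). f x)"

(* Matrix measures are functions on all sets of reals, but only their values at
   Borel sets matter. *)
definition pos_matrix_measure :: "nat \<Rightarrow> (real set \<Rightarrow> real mat) \<Rightarrow> bool" where
  "pos_matrix_measure p \<mu> \<longleftrightarrow>
     (\<forall>i<p. \<forall>j<p. signed_measure (\<lambda>B. \<mu> B $$ (i, j))) \<and>
     (\<forall>B \<in> sets borel. pos_semidef p (\<mu> B))"

definition trace_measure :: "nat \<Rightarrow> (real set \<Rightarrow> real mat) \<Rightarrow> real measure" where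
  "trace_measure p \<mu> =
     measure_of UNIV (sets borel) (\<lambda>B. ennreal (\<Sum>i<p. \<mu> B $$ (i, i)))"

definition matrix_integral :: "nat \<Rightarrow> (real set \<Rightarrow> real mat) \<Rightarrow> (real \<Rightarrow> real) \<Rightarrow> real mat" where
  "matrix_integral p \<mu> f =
     Matrix.mat p p (\<lambda>(i, j). signed_integral (\<lambda>B. \<mu> B $$ (i, j)) f)"

definition representing_measure ::
  "nat \<Rightarrow> nat \<Rightarrow> (real poly \<Rightarrow> real mat) \<Rightarrow> (real set \<Rightarrow> real mat) \<Rightarrow> bool" where
  "representing_measure p d L \<mu> \<longleftrightarrow> pos_matrix_measure p \<mu> \<and>
     (\<forall>q. degree q \<le> d \<longrightarrow>
        integrable (trace_measure p \<mu>) (poly q) \<and> L q = matrix_integral p \<mu> (poly q))"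

(* mu is the sum of A j times the Dirac measure at x j, over j < l; the value of that
   Dirac measure at B is indicat_real B (x j). *)
definition atomic_form ::
  "nat \<Rightarrow> (real set \<Rightarrow> real mat) \<Rightarrow> nat \<Rightarrow> (nat \<Rightarrow> real mat) \<Rightarrow> (nat \<Rightarrow> real) \<Rightarrow> bool" where
  "atomic_form p \<mu> l A x \<longleftrightarrow>
     (\<forall>j<l. pos_semidef p (A j) \<and> A j \<noteq> 0\<^sub>m p p) \<and> inj_on x {..<l} \<and>
     (\<forall>B \<in> sets borel. \<mu> B =
        Matrix.mat p p (\<lambda>(a, b). \<Sum>j<l. A j $$ (a, b) * indicat_real B (x j)))"

definition minimal_representing_measure ::
  "nat \<Rightarrow> nat \<Rightarrow> (real poly \<Rightarrow> real mat) \<Rightarrow> (real set \<Rightarrow> real mat) \<Rightarrow> bool" where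
  "minimal_representing_measure p d L \<mu> \<longleftrightarrow> representing_measure p d L \<mu> \<and>
     (\<exists>l A x. atomic_form p \<mu> l A x \<and>
        (\<forall>\<mu>' l' A' x'. representing_measure p d L \<mu>' \<longrightarrow> atomic_form p \<mu>' l' A' x' \<longrightarrow>
           (\<Sum>j<l. mat_rank p (A j)) \<le> (\<Sum>j<l'. mat_rank p (A' j))))"

(* For a finitely atomic measure this is the rank of the mass at t if t is an atom,
   and the rank of the zero matrix, hence 0, otherwise. *)
definition multiplicity_at :: "nat \<Rightarrow> (real set \<Rightarrow> real mat) \<Rightarrow> real \<Rightarrow> nat" where
  "multiplicity_at p \<mu> t = mat_rank p (\<mu> {t})"

end

theory Submission
  imports Defs
begin

text \<open>
  Any finitely atomic representing measure has total rank at least \<open>(n + 1) p\<close>: the moment matrix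
  is the sum over the atoms of the matrices with blocks \<open>x\<^sub>m\<^sup>i x\<^sub>m\<^sup>j A\<^sub>m\<close>, each of rank at most
  the rank of \<open>A\<^sub>m\<close>, and it has full rank \<open>(n + 1) p\<close>. So it suffices to find a representing
  measure of total rank at most \<open>(n + 1) p\<close> without an atom at \<open>t\<close>.

  Such measures come from the choice of one further symmetric moment \<open>S\<^bsub>2n+1\<^esub>\<close>. It makes the shifted
  Hankel matrix \<open>H\<close> with blocks \<open>S\<^bsub>i+j+1\<^esub>\<close> available next to the moment matrix \<open>M\<close> with blocks
  \<open>S\<^bsub>i+j\<^esub>\<close>. Since \<open>M\<close> is positive definite, both are diagonal in one basis: \<open>M\<close> is the sum of
  the matrices \<open>w\<^sub>k w\<^sub>k\<^sup>T\<close> and \<open>H\<close> the sum of \<open>l\<^sub>k w\<^sub>k w\<^sub>k\<^sup>T\<close>, where the \<open>(n + 1) p\<close> vectors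
  \<open>w\<^sub>k\<close> are linearly independent (\<open>simultaneous_diagonalization\<close>). The blocks
  \<open>(i, j)\<close> of \<open>H\<close> and \<open>(i, j + 1)\<close> of \<open>M\<close> agree, and independence turns this into
  \<open>w\<^sub>k(j + 1) = l\<^sub>k w\<^sub>k(j)\<close> for the blocks of \<open>w\<^sub>k\<close>. Hence \<open>w\<^sub>k(j) = l\<^sub>k\<^sup>j w\<^sub>k(0)\<close>, and the
  decomposition of \<open>M\<close> says that the measure with masses \<open>w\<^sub>k(0) w\<^sub>k(0)\<^sup>T\<close> at the points \<open>l\<^sub>k\<close> has the
  moments \<open>S\<^sub>0, \<dots>, S\<^bsub>2n\<^esub>\<close> (\<open>quadrature_avoiding_point\<close>).

  The point \<open>t\<close> is one of the \<open>l\<^sub>k\<close> exactly if \<open>H - t M\<close> is singular. Put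
  \<open>S\<^bsub>2n+1\<^esub> = s \<cdot> 1\<close>; then \<open>s\<close> enters \<open>H - t M\<close> only through the last diagonal block. Kernel
  vectors that belong to different values of \<open>s\<close> have orthogonal last blocks, and these are nonzero,
  because a kernel vector with zero last block is zero: it encodes a vector polynomial \<open>q\<close> of degree
  less than \<open>n\<close>, and \<open>M\<close> annihilates \<open>(x - t) q\<close>. As the last blocks live in a space of
  dimension \<open>p\<close>, at most \<open>p\<close> values of \<open>s\<close> are bad (\<open>regular_moment_extension\<close>).

  Vectors and matrices are functions on a finite index set here; for the moment matrix this is the
  set of pairs of a block number and a position in the block. This makes induction on
  the size possible and keeps the block structure visible.
\<close>

section \<open>Linear systems and quadratic forms on finite index sets\<close>

text \<open>
  Gaussian elimination. All dimension counts below, including those for matrix ranks, rest on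
  this.
\<close>

lemma nontrivial_kernel:
  fixes d :: "'k \<Rightarrow> 'b \<Rightarrow> real"
  assumes "finite K" "finite B" "card K < card B"
  shows "\<exists>y. (\<exists>b\<in>B. y b \<noteq> 0) \<and> (\<forall>k\<in>K. (\<Sum>b\<in>B. y b * d k b) = 0)"
  using assms
proof (induction K arbitrary: B d rule: finite_induct)
  case empty
  then have "B \<noteq> {}" by auto
  then show ?case by (intro exI[of _ "\<lambda>_. 1"]) auto
next
  case (insert k K)
  show ?case
  proof (cases "\<forall>b\<in>B. d k b = 0")
    case True
    from insert.IH[OF insert.prems(1), of d] insert.prems insert.hyps
    obtain y where "\<exists>b\<in>B. y b \<noteq> 0" "\<forall>k\<in>K. (\<Sum>b\<in>B. y b * d k b) = 0"
      by auto
    with True show ?thesis by (intro exI[of _ y]) auto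
  next
    case False
    then obtain c where c: "c \<in> B" "d k c \<noteq> 0" by auto
    \<comment> \<open>Equation \<open>k\<close> is used to eliminate the unknown \<open>c\<close> from the others.\<close>
    define e where "e = (\<lambda>j b. d j b - d j c * d k b / d k c)"
    have "card K < card (B - {c})" using insert c by simp
    from insert.IH[OF _ this, of e] insert.prems
    obtain y where y: "\<exists>b\<in>B - {c}. y b \<noteq> 0"
      "\<And>j. j \<in> K \<Longrightarrow> (\<Sum>b\<in>B - {c}. y b * e j b) = 0"
      by auto
    define s where "s = (\<Sum>b\<in>B - {c}. y b * d k b)"
    define z where "z = y(c := - s / d k c)"
    have zsum: "(\<Sum>b\<in>B. z b * d j b) = (\<Sum>b\<in>B - {c}. y b * d j b) - s / d k c * d j c" for j
    proof -
      have "(\<Sum>b\<in>B. z b * d j b) = z c * d j c + (\<Sum>b\<in>B - {c}. z b * d j b)"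
        using c insert.prems by (subst sum.remove[of _ c]) auto
      also have "(\<Sum>b\<in>B - {c}. z b * d j b) = (\<Sum>b\<in>B - {c}. y b * d j b)"
        by (intro sum.cong) (auto simp: z_def)
      finally show ?thesis by (simp add: z_def)
    qed
    have "(\<Sum>b\<in>B. z b * d k b) = 0"
      using c by (simp add: zsum s_def)
    moreover have "(\<Sum>b\<in>B. z b * d j b) = 0" if "j \<in> K" for j
    proof -
      have "0 = (\<Sum>b\<in>B - {c}. y b * e j b)" using y that by simp
      also have "\<dots> = (\<Sum>b\<in>B - {c}. y b * d j b) - s / d k c * d j c"
        unfolding e_def s_def
        by (simp add: algebra_simps sum_subtractf sum_distrib_left sum_divide_distrib)
      finally show ?thesis by (simp add: zsum)
    qed
    moreover have "\<exists>b\<in>B. z b \<noteq> 0"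
      using y(1) by (auto simp: z_def)
    ultimately show ?thesis by (intro exI[of _ z]) auto
  qed
qed

text \<open>
  A linear relation between pairwise orthogonal vectors, as more vectors than coordinates would
  force, contradicts orthogonality when paired with a vector that occurs in it.
\<close>

lemma card_orthogonal_le:
  fixes f :: "'k \<Rightarrow> 'b \<Rightarrow> real"
  assumes "finite K" "finite B"
    and orth: "\<And>k m. k \<in> K \<Longrightarrow> m \<in> K \<Longrightarrow> k \<noteq> m \<Longrightarrow> (\<Sum>b\<in>B. f k b * f m b) = 0"
    and nz: "\<And>k. k \<in> K \<Longrightarrow> \<exists>b\<in>B. f k b \<noteq> 0"
  shows "card K \<le> card B"
proof (rule ccontr)
  assume "\<not> card K \<le> card B"
  then have "card B < card K" by simp
  from nontrivial_kernel[OF assms(2,1) this, of "\<lambda>b k. f k b"]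
  obtain y m where y: "m \<in> K" "y m \<noteq> 0" "\<And>b. b \<in> B \<Longrightarrow> (\<Sum>k\<in>K. y k * f k b) = 0"
    by blast
  have "0 = (\<Sum>b\<in>B. (\<Sum>k\<in>K. y k * f k b) * f m b)" using y(3) by simp
  also have "\<dots> = (\<Sum>k\<in>K. y k * (\<Sum>b\<in>B. f k b * f m b))"
    by (simp add: sum_distrib_right sum_distrib_left mult.assoc) (rule sum.swap)
  also have "\<dots> = (\<Sum>k\<in>K. if k = m then y m * (\<Sum>b\<in>B. f m b * f m b) else 0)"
    using orth y(1) by (intro sum.cong) auto
  also have "\<dots> = y m * (\<Sum>b\<in>B. f m b * f m b)"
    using y(1) assms(1) by simp
  finally have "(\<Sum>b\<in>B. f m b * f m b) = 0" using y(2) by simp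
  then have "\<forall>b\<in>B. f m b = 0" using assms(2) by (simp add: sum_nonneg_eq_0_iff)
  with nz[OF y(1)] show False by blast
qed

definition bform :: "'i set \<Rightarrow> ('i \<Rightarrow> 'i \<Rightarrow> real) \<Rightarrow> ('i \<Rightarrow> real) \<Rightarrow> ('i \<Rightarrow> real) \<Rightarrow> real" where
  "bform I M u v = (\<Sum>a\<in>I. u a * (\<Sum>b\<in>I. M a b * v b))"

definition sym_on :: "'i set \<Rightarrow> ('i \<Rightarrow> 'i \<Rightarrow> real) \<Rightarrow> bool" where
  "sym_on I M \<longleftrightarrow> (\<forall>a\<in>I. \<forall>b\<in>I. M a b = M b a)"

definition posdef_on :: "'i set \<Rightarrow> ('i \<Rightarrow> 'i \<Rightarrow> real) \<Rightarrow> bool" where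
  "posdef_on I M \<longleftrightarrow> (\<forall>u. (\<exists>a\<in>I. u a \<noteq> 0) \<longrightarrow> bform I M u u > 0)"

lemma bform_commute:
  assumes "sym_on I M" shows "bform I M u v = bform I M v u"
proof -
  have "bform I M u v = (\<Sum>a\<in>I. \<Sum>b\<in>I. u a * (M a b * v b))"
    by (simp add: bform_def sum_distrib_left)
  also have "\<dots> = (\<Sum>b\<in>I. \<Sum>a\<in>I. u a * (M a b * v b))" by (rule sum.swap)
  also have "\<dots> = (\<Sum>b\<in>I. \<Sum>a\<in>I. v b * (M b a * u a))"
    using assms by (intro sum.cong) (auto simp: sym_on_def)
  also have "\<dots> = bform I M v u" by (simp add: bform_def sum_distrib_left)
  finally show ?thesis .
qed

lemma bform_add_left: "bform I M (\<lambda>a. u a + c * v a) w = bform I M u w + c * bform I M v w"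
  by (simp add: bform_def algebra_simps sum.distrib sum_distrib_left)

lemma bform_add_right: "bform I M w (\<lambda>a. u a + c * v a) = bform I M w u + c * bform I M w v"
  by (simp add: bform_def algebra_simps sum.distrib sum_distrib_left)

lemma bform_scale: "bform I M (\<lambda>a. c * u a) (\<lambda>a. c * u a) = c\<^sup>2 * bform I M u u"
  by (simp add: bform_def sum_distrib_left power2_eq_square mult_ac)

lemma bform_diff: "bform I (\<lambda>a b. c * M a b - H a b) u v = c * bform I M u v - bform I H u v"
  by (simp add: bform_def algebra_simps sum_subtractf sum_distrib_left)

lemma bform_add_square:
  assumes "sym_on I M"
  shows "bform I M (\<lambda>a. u a + c * v a) (\<lambda>a. u a + c * v a) =
    bform I M u u + 2 * c * bform I M u v + c\<^sup>2 * bform I M v v"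
  unfolding bform_add_left bform_add_right
  by (simp add: bform_commute[OF assms, of v u] algebra_simps power2_eq_square)

lemma bform_cong: 
  assumes "\<And>a. a \<in> I \<Longrightarrow> u a = u' a" "\<And>a. a \<in> I \<Longrightarrow> v a = v' a"
  shows "bform I M u v = bform I M u' v'"
  using assms by (simp add: bform_def)

lemma bform_unit: 
  assumes "finite I" "i \<in> I"
  shows "bform I M (\<lambda>a. if a = i then 1 else 0) v = (\<Sum>b\<in>I. M i b * v b)"
proof -
  have "bform I M (\<lambda>a. if a = i then 1 else 0) v = 
     (\<Sum>a\<in>I. if a = i then (\<Sum>b\<in>I. M i b * v b) else 0)"
    unfolding bform_def by (intro sum.cong) auto
  with assms show ?thesis by simp
qed

text \<open>
  The form is nonnegative along the line \<open>u + c v\<close>, so the term that is linear in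
  \<open>c\<close> has to vanish.
\<close>

lemma isotropic_in_kernel:
  assumes "finite I" "sym_on I G" and psd: "\<And>v. bform I G v v \<ge> 0"
    and "bform I G u u = 0" "i \<in> I"
  shows "(\<Sum>b\<in>I. G i b * u b) = 0"
proof -
  define v where "v = (\<lambda>a. if a = i then 1 else (0::real))"
  define b where "b = bform I G u v"
  define c where "c = bform I G v v"
  have c: "c \<ge> 0" using psd by (simp add: c_def)
  \<comment> \<open>The step \<open>- b / c\<close> would be optimal; \<open>c + 1\<close> also covers \<open>c = 0\<close>.\<close>
  have "0 \<le> bform I G (\<lambda>a. u a + (- b / (c + 1)) * v a) (\<lambda>a. u a + (- b / (c + 1)) * v a)"
    by (rule psd)
  also have "\<dots> = 2 * (- b / (c + 1)) * b + (- b / (c + 1))\<^sup>2 * c"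
    unfolding bform_add_square[OF assms(2)] using assms(4) by (simp add: b_def c_def)
  also have "\<dots> = - (b\<^sup>2 * (c + 2)) / (c + 1)\<^sup>2"
    using c by (simp add: field_simps power2_eq_square add_nonneg_eq_0_iff)
  finally have "b\<^sup>2 * (c + 2) \<le> 0"
    using c by (simp add: zero_le_divide_iff divide_le_0_iff)
  then have "b = 0" using c
    by (smt (verit) mult_pos_pos zero_less_power2)
  then have "bform I G v u = 0" using bform_commute[OF assms(2)] by (simp add: b_def)
  then show ?thesis unfolding v_def using bform_unit[OF assms(1,5)] by simp
qed

text \<open>
  Vectors are extended by zero outside \<open>I\<close>: Tychonoff's theorem for the product
  topology then gives compactness for index sets of every size, without a type for each
  dimension.
\<close>

lemma compact_unit_sphere_functions:
  assumes "finite I"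
  shows "compact {u :: 'i \<Rightarrow> real. (\<Sum>a\<in>I. (u a)\<^sup>2) = 1 \<and> (\<forall>a. a \<notin> I \<longrightarrow> u a = 0)}" (is "compact ?K")
proof -
  define C where "C = PiE UNIV (\<lambda>a. if a \<in> I then {-1..1} else {0::real})"
  have "compactin (product_topology (\<lambda>i. euclidean) UNIV) C"
    unfolding C_def compactin_PiE by auto
  then have C: "compact C" by (simp add: euclidean_product_topology)
  have "continuous_on UNIV (\<lambda>u :: 'i \<Rightarrow> real. \<Sum>a\<in>I. (u a)\<^sup>2)"
    by (intro continuous_intros continuous_on_product_coordinates)
  then have "closed {u :: 'i \<Rightarrow> real. (\<Sum>a\<in>I. (u a)\<^sup>2) = 1}"
    by (intro closed_Collect_eq) auto
  with C have *: "compact (C \<inter> {u. (\<Sum>a\<in>I. (u a)\<^sup>2) = 1})"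
    by (rule compact_Int_closed)
  have "\<bar>u a\<bar> \<le> 1" if "(\<Sum>a\<in>I. (u a)\<^sup>2) = 1" "a \<in> I" for u :: "'i \<Rightarrow> real" and a
  proof -
    have "(u a)\<^sup>2 \<le> (\<Sum>a\<in>I. (u a)\<^sup>2)"
      using assms that(2) by (intro member_le_sum) auto
    with that(1) show ?thesis by (simp add: abs_square_le_1)
  qed
  then have "?K = C \<inter> {u. (\<Sum>a\<in>I. (u a)\<^sup>2) = 1}"
    by (auto simp: C_def PiE_iff abs_le_iff split: if_splits)
  with * show ?thesis by simp
qed

text \<open>
  A maximizer of the Rayleigh quotient of \<open>H\<close> by \<open>M\<close>, with maximum
  \<open>l\<close>, is isotropic for the positive semidefinite form \<open>l M - H\<close> and
  so lies in its kernel.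
\<close>

lemma generalized_eigenvector:
  fixes M H :: "'i \<Rightarrow> 'i \<Rightarrow> real"
  assumes fin: "finite I" and "I \<noteq> {}" and sM: "sym_on I M" and sH: "sym_on I H" and pd: "posdef_on I M"
  shows "\<exists>u l. bform I M u u = 1 \<and> (\<forall>a\<in>I. (\<Sum>b\<in>I. H a b * u b) = l * (\<Sum>b\<in>I. M a b * u b))"
proof -
  define K where "K = {u :: 'i \<Rightarrow> real. (\<Sum>a\<in>I. (u a)\<^sup>2) = 1 \<and> (\<forall>a. a \<notin> I \<longrightarrow> u a = 0)}"
  have nzK: "\<exists>a\<in>I. u a \<noteq> 0" if "u \<in> K" for u
    using that by (rule_tac ccontr) (auto simp: K_def)
  have posK: "bform I M u u > 0" if "u \<in> K" for u
    using nzK[OF that] pd by (auto simp: posdef_on_def)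
  obtain i where i: "i \<in> I" using \<open>I \<noteq> {}\<close> by auto
  have "(\<lambda>a. if a = i then 1 else 0) \<in> K"
    using i fin by (auto simp: K_def if_distrib[of "\<lambda>x. x\<^sup>2"] cong: if_cong)
  then have neK: "K \<noteq> {}" by auto
  have cont: "continuous_on UNIV (\<lambda>u :: 'i \<Rightarrow> real. bform I X u u)" for X
    unfolding bform_def by (intro continuous_intros continuous_on_product_coordinates)
  have "continuous_on K (\<lambda>u. bform I H u u / bform I M u u)"
    by (intro continuous_intros continuous_on_subset[OF cont])
      (use posK in \<open>auto simp: less_le\<close>)
  from continuous_attains_sup[OF _ neK this]
  obtain v where v: "v \<in> K" "\<And>w. w \<in> K \<Longrightarrow> 
      bform I H w w / bform I M w w \<le> bform I H v v / bform I M v v"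
    using compact_unit_sphere_functions[OF fin] by (auto simp: K_def)
  define l where "l = bform I H v v / bform I M v v"
  define G where "G = (\<lambda>a b. l * M a b - H a b)"
  have psd: "bform I G w w \<ge> 0" for w
  proof (cases "\<exists>a\<in>I. w a \<noteq> 0")
    case False
    then have "bform I G w w = 0" by (simp add: bform_def)
    then show ?thesis by simp
  next
    case True
    define s where "s = sqrt (\<Sum>a\<in>I. (w a)\<^sup>2)"
    define z where "z = (\<lambda>a. if a \<in> I then (1 / s) * w a else 0)"
    have "(\<Sum>a\<in>I. (w a)\<^sup>2) > 0"
      using True fin by (meson sum_pos2 zero_le_power2 zero_less_power2)
    then have s: "s > 0" "s\<^sup>2 = (\<Sum>a\<in>I. (w a)\<^sup>2)" by (auto simp: s_def)
    have "(\<Sum>a\<in>I. (z a)\<^sup>2) = (\<Sum>a\<in>I. (w a)\<^sup>2 / s\<^sup>2)"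
      by (intro sum.cong) (auto simp: z_def power_divide)
    also have "\<dots> = 1" using s(1) by (simp add: sum_divide_distrib[symmetric] flip: s(2))
    finally have "z \<in> K" by (auto simp: K_def z_def)
    then have "bform I H z z \<le> l * bform I M z z"
      using v(2)[of z] posK[of z] by (simp add: l_def[symmetric] field_simps)
    then have "0 \<le> bform I G z z" by (simp add: G_def bform_diff)
    also have "bform I G z z = bform I G (\<lambda>a. (1 / s) * w a) (\<lambda>a. (1 / s) * w a)"
      by (rule bform_cong) (auto simp: z_def)
    also have "\<dots> = (1 / s)\<^sup>2 * bform I G w w" by (rule bform_scale)
    finally show ?thesis using s by (simp add: zero_le_mult_iff zero_le_divide_iff)
  qed
  have "sym_on I G" using sM sH by (auto simp: sym_on_def G_def)
  moreover have "bform I G v v = 0"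
    using posK[OF v(1)] unfolding G_def bform_diff l_def by simp
  ultimately have ker: "(\<Sum>b\<in>I. G a b * v b) = 0" if "a \<in> I" for a
    using isotropic_in_kernel[OF fin _ psd _ that] by blast
  have eig: "(\<Sum>b\<in>I. H a b * v b) = l * (\<Sum>b\<in>I. M a b * v b)" if "a \<in> I" for a
    using ker[OF that] by (simp add: G_def algebra_simps sum_subtractf sum_distrib_left)
  define r where "r = 1 / sqrt (bform I M v v)"
  have "bform I M (\<lambda>a. r * v a) (\<lambda>a. r * v a) = 1"
    unfolding bform_scale using posK[OF v(1)] by (simp add: r_def power_divide)
  moreover have "(\<Sum>b\<in>I. H a b * (r * v b)) = l * (\<Sum>b\<in>I. M a b * (r * v b))" if "a \<in> I" for a
    using arg_cong[OF eig[OF that], of "\<lambda>x. r * x"]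
    by (simp add: sum_distrib_left mult_ac)
  ultimately show ?thesis by blast
qed

section \<open>Simultaneous diagonalization\<close>

text \<open>
  A vector \<open>u\<close> in the kernel with \<open>u i \<noteq> 0\<close> expresses row and
  column \<open>i\<close> of a symmetric matrix through the other entries. This lets the
  deflation step below remove one index instead of passing to a subspace.
\<close>

lemma sym_eq_by_kernel:
  fixes X Y :: "'i \<Rightarrow> 'i \<Rightarrow> real"
  assumes "finite I" "i \<in> I" "u i \<noteq> 0" "sym_on I X" "sym_on I Y"
    and eq: "\<And>a b. a \<in> I - {i} \<Longrightarrow> b \<in> I - {i} \<Longrightarrow> X a b = Y a b"
    and kX: "\<And>a. a \<in> I \<Longrightarrow> (\<Sum>b\<in>I. X a b * u b) = 0"
    and kY: "\<And>a. a \<in> I \<Longrightarrow> (\<Sum>b\<in>I. Y a b * u b) = 0"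
    and ab: "a \<in> I" "b \<in> I"
  shows "X a b = Y a b"
proof -
  have split: "(\<Sum>b\<in>I. Z a b * u b) = Z a i * u i + (\<Sum>b\<in>I - {i}. Z a b * u b)"
    for Z :: "'i \<Rightarrow> 'i \<Rightarrow> real" and a
    using assms(1,2) by (subst sum.remove[of _ i]) auto
  have last: "X a i = Y a i" if "a \<in> I" "\<And>b. b \<in> I - {i} \<Longrightarrow> X a b = Y a b" for a
  proof -
    have "(\<Sum>b\<in>I - {i}. X a b * u b) = (\<Sum>b\<in>I - {i}. Y a b * u b)"
      using that(2) by (intro sum.cong) auto
    then have "X a i * u i = Y a i * u i"
      using kX[OF that(1)] kY[OF that(1)] split[of X a] split[of Y a] by linarith
    with \<open>u i \<noteq> 0\<close> show ?thesis by simp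
  qed
  have col: "X a i = Y a i" if "a \<in> I - {i}" for a
    using last[of a] eq that by blast
  have row: "X i a = Y i a" if "a \<in> I - {i}" for a
    using col[OF that] assms(2,4,5) that unfolding sym_on_def by (metis DiffD1)
  have "X i i = Y i i" using last[OF assms(2) row] .
  with col row eq ab show ?thesis by (metis Diff_iff singletonD)
qed

lemma bform_minus_rank_one:
  "bform I (\<lambda>a b. M a b - g a * g b) u v = bform I M u v - (\<Sum>a\<in>I. u a * g a) * (\<Sum>b\<in>I. g b * v b)"
proof -
  have "(\<Sum>b\<in>I. (M a b - g a * g b) * v b) = (\<Sum>b\<in>I. M a b * v b) - g a * (\<Sum>b\<in>I. g b * v b)" for a
    by (simp add: left_diff_distrib sum_subtractf sum_distrib_left mult.assoc)
  then show ?thesis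
    by (simp add: bform_def right_diff_distrib sum_subtractf sum_distrib_right mult.assoc)
qed

text \<open>
  Splitting off a generalized eigenvector \<open>v\<close> leaves two matrices that annihilate
  \<open>v\<close>. They are determined by their restriction to \<open>J\<close>, which is
  \<open>I\<close> without one index where \<open>v\<close> is nonzero, and the first of them is
  positive definite on \<open>J\<close>; so induction on the size of \<open>I\<close> applies.
  The family \<open>u\<close>, dual to \<open>w\<close>, records that \<open>w\<close> is a
  basis.
\<close>

lemma simultaneous_diagonalization:
  fixes M H :: "'i \<Rightarrow> 'i \<Rightarrow> real"
  assumes "finite I" "sym_on I M" "sym_on I H" "posdef_on I M"
  shows "\<exists>w u l. (\<forall>a\<in>I. \<forall>b\<in>I. M a b = (\<Sum>k\<in>I. w k a * w k b))
    \<and> (\<forall>a\<in>I. \<forall>b\<in>I. H a b = (\<Sum>k\<in>I. l k * w k a * w k b))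
    \<and> (\<forall>k\<in>I. \<forall>m\<in>I. (\<Sum>a\<in>I. w k a * u m a) = (if k = m then 1 else 0))"
  using assms
proof (induction "card I" arbitrary: I M H)
  case 0
  then show ?case by auto
next
  case (Suc n)
  note fin = \<open>finite I\<close> and sM = \<open>sym_on I M\<close> and sH = \<open>sym_on I H\<close> and pd = \<open>posdef_on I M\<close>
  from Suc(2) have "I \<noteq> {}" by auto
  from generalized_eigenvector[OF fin this sM sH pd]
  obtain v l0 where v1: "bform I M v v = 1"
    and eig: "\<And>a. a \<in> I \<Longrightarrow> (\<Sum>b\<in>I. H a b * v b) = l0 * (\<Sum>b\<in>I. M a b * v b)"
    by blast
  have "\<exists>i\<in>I. v i \<noteq> 0"
  proof (rule ccontr)
    assume "\<not> ?thesis"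
    then have "bform I M v v = 0" by (simp add: bform_def)
    with v1 show False by simp
  qed
  then obtain i where i: "i \<in> I" "v i \<noteq> 0" by blast
  define J where "J = I - {i}"
  have finJ: "finite J" and iJ: "i \<notin> J" and IJ: "I = insert i J" and JI: "\<And>a. a \<in> J \<Longrightarrow> a \<in> I"
    using fin i by (auto simp: J_def)
  define g where "g = (\<lambda>a. \<Sum>b\<in>I. M a b * v b)"
  have gv: "(\<Sum>a\<in>I. g a * v a) = 1"
    using v1 by (simp add: bform_def g_def mult.commute)
  define M' where "M' = (\<lambda>a b. M a b - g a * g b)"
  define H' where "H' = (\<lambda>a b. H a b - l0 * g a * g b)"
  have sM': "sym_on I M'" and sH': "sym_on I H'"
    using sM sH by (auto simp: sym_on_def M'_def H'_def)
  have kM': "(\<Sum>b\<in>I. M' a b * v b) = 0" if "a \<in> I" for a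
  proof -
    have "(\<Sum>b\<in>I. M' a b * v b) = (\<Sum>b\<in>I. M a b * v b) - g a * (\<Sum>b\<in>I. g b * v b)"
      by (simp add: M'_def left_diff_distrib sum_subtractf sum_distrib_left mult.assoc)
    with gv show ?thesis by (simp add: g_def)
  qed
  have kH': "(\<Sum>b\<in>I. H' a b * v b) = 0" if "a \<in> I" for a
  proof -
    have "(\<Sum>b\<in>I. H' a b * v b) = (\<Sum>b\<in>I. H a b * v b) - l0 * g a * (\<Sum>b\<in>I. g b * v b)"
      by (simp add: H'_def left_diff_distrib sum_subtractf sum_distrib_left mult.assoc)
    with gv eig[OF that] show ?thesis by (simp add: g_def)
  qed
  have pdJ: "posdef_on J M'"
    unfolding posdef_on_def
  proof (intro allI impI)
    fix z :: "'i \<Rightarrow> real" assume z: "\<exists>a\<in>J. z a \<noteq> 0"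
    define y where "y = (\<lambda>a. if a = i then 0 else z a)"
    define c where "c = (\<Sum>a\<in>I. y a * g a)"
    have c: "c = bform I M y v" by (simp add: c_def bform_def g_def)
    have "\<exists>a\<in>I. y a + (-c) * v a \<noteq> 0"
    proof (cases "c = 0")
      case True
      from z obtain a where "a \<in> J" "z a \<noteq> 0" by blast
      with True iJ JI show ?thesis by (intro bexI[of _ a]) (auto simp: y_def)
    next
      case False
      with i show ?thesis by (intro bexI[of _ i]) (auto simp: y_def)
    qed
    then have "bform I M (\<lambda>a. y a + (-c) * v a) (\<lambda>a. y a + (-c) * v a) > 0"
      using pd unfolding posdef_on_def by (elim allE[where x = "\<lambda>a. y a + (-c) * v a"] impE)
    also have "bform I M (\<lambda>a. y a + (-c) * v a) (\<lambda>a. y a + (-c) * v a) = bform I M y y - c\<^sup>2"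
      unfolding bform_add_square[OF sM] v1 c[symmetric] by (simp add: power2_eq_square)
    also have "\<dots> = bform I M' y y"
      unfolding M'_def bform_minus_rank_one by (simp add: c_def power2_eq_square mult.commute)
    also have "\<dots> = bform J M' z z"
      unfolding bform_def IJ using finJ iJ
      by (auto simp: y_def intro!: sum.cong)
    finally show "bform J M' z z > 0" .
  qed
  have "n = card J" using Suc(2) fin i by (simp add: J_def)
  moreover have "sym_on J M'" "sym_on J H'" using sM' sH' JI by (auto simp: sym_on_def)
  ultimately obtain w u l
    where wM: "\<And>a b. a \<in> J \<Longrightarrow> b \<in> J \<Longrightarrow> M' a b = (\<Sum>k\<in>J. w k a * w k b)"
      and wH: "\<And>a b. a \<in> J \<Longrightarrow> b \<in> J \<Longrightarrow> H' a b = (\<Sum>k\<in>J. l k * w k a * w k b)"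
      and wu: "\<And>k m. k \<in> J \<Longrightarrow> m \<in> J \<Longrightarrow> (\<Sum>a\<in>J. w k a * u m a) = (if k = m then 1 else 0)"
    using Suc(1)[of J M' H'] finJ pdJ by blast
  \<comment> \<open>The value at \<open>i\<close> makes the extended vectors orthogonal to \<open>v\<close>.\<close>
  define x where "x = (\<lambda>k a. if a = i then - (\<Sum>b\<in>J. w k b * v b) / v i else w k a)"
  have sumI: "(\<Sum>a\<in>I. f a) = f i + (\<Sum>a\<in>J. f a)" for f :: "'i \<Rightarrow> real"
    using finJ iJ by (simp add: IJ)
  have xJ: "x k a = w k a" if "a \<in> J" for k a using that iJ by (auto simp: x_def)
  have xv: "(\<Sum>a\<in>I. x k a * v a) = 0" for k
  proof -
    have "(\<Sum>a\<in>J. x k a * v a) = (\<Sum>a\<in>J. w k a * v a)" by (simp add: xJ)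
    then show ?thesis using i by (simp add: sumI) (simp add: x_def)
  qed
  have xker: "(\<Sum>b\<in>I. (\<Sum>k\<in>J. d k * x k a * x k b) * v b) = 0" for d :: "'i \<Rightarrow> real" and a
  proof -
    have "(\<Sum>b\<in>I. (\<Sum>k\<in>J. d k * x k a * x k b) * v b) =
      (\<Sum>k\<in>J. d k * x k a * (\<Sum>b\<in>I. x k b * v b))"
      by (simp add: sum_distrib_right sum_distrib_left mult.assoc) (rule sum.swap)
    with xv show ?thesis by simp
  qed
  have symx: "sym_on I (\<lambda>a b. \<Sum>k\<in>J. d k * x k a * x k b)" for d :: "'i \<Rightarrow> real"
    by (simp add: sym_on_def mult_ac)
  have xM: "M' a b = (\<Sum>k\<in>J. 1 * x k a * x k b)" if "a \<in> I" "b \<in> I" for a b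
    by (rule sym_eq_by_kernel[OF fin i(1) i(2) sM' symx _ kM' xker that])
      (use wM in \<open>auto simp: J_def[symmetric] xJ\<close>)
  have xH: "H' a b = (\<Sum>k\<in>J. l k * x k a * x k b)" if "a \<in> I" "b \<in> I" for a b
    by (rule sym_eq_by_kernel[OF fin i(1) i(2) sH' symx _ kH' xker that])
      (use wH in \<open>auto simp: J_def[symmetric] xJ\<close>)
  define W where "W = x(i := g)"
  define l' where "l' = l(i := l0)"
  \<comment> \<open>Subtracting a multiple of \<open>v\<close> makes the old dual vectors vanish on \<open>g\<close> and, as \<open>v\<close> is orthogonal to all \<open>x k\<close>, changes no other pairing.\<close>
  define c where "c = (\<lambda>k. \<Sum>a\<in>J. g a * u k a)"
  define y where "y = (\<lambda>k a. (if a = i then 0 else u k a) - c k * v a)"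
  define U where "U = y(i := v)"
  have WJ: "W k = x k" "l' k = l k" "U k = y k" if "k \<in> J" for k
    using that iJ by (auto simp: W_def l'_def U_def)
  have Wi: "W i = g" "l' i = l0" "U i = v" by (auto simp: W_def l'_def U_def)
  have "M a b = (\<Sum>k\<in>I. W k a * W k b)" if "a \<in> I" "b \<in> I" for a b
    using xM[OF that] by (simp add: sumI Wi WJ M'_def)
  moreover have "H a b = (\<Sum>k\<in>I. l' k * W k a * W k b)" if "a \<in> I" "b \<in> I" for a b
    using xH[OF that] by (simp add: sumI Wi WJ H'_def)
  moreover have "(\<Sum>a\<in>I. W k a * U m a) = (if k = m then 1 else 0)" if km: "k \<in> I" "m \<in> I" for k m
  proof -
    have sy: "(\<Sum>a\<in>I. f a * y m a) = (\<Sum>a\<in>J. f a * u m a) - c m * (\<Sum>a\<in>I. f a * v a)"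
      for f :: "'i \<Rightarrow> real" and m
    proof -
      have "(\<Sum>a\<in>I. f a * y m a) = (\<Sum>a\<in>I. f a * (if a = i then 0 else u m a)) - c m * (\<Sum>a\<in>I. f a * v a)"
        by (simp add: y_def right_diff_distrib sum_subtractf sum_distrib_left mult_ac)
      also have "(\<Sum>a\<in>I. f a * (if a = i then 0 else u m a)) = (\<Sum>a\<in>J. f a * u m a)"
        using iJ by (auto simp: sumI intro!: sum.cong)
      finally show ?thesis .
    qed
    consider "k = i" "m = i" | "k = i" "m \<in> J" | "k \<in> J" "m = i" | "k \<in> J" "m \<in> J"
      using km by (auto simp: J_def)
    then show ?thesis
    proof cases
      case 1
      then show ?thesis using gv by (simp add: Wi)
    next
      case 2
      then show ?thesis using gv iJ by (auto simp: Wi WJ sy c_def)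
    next
      case 3
      then show ?thesis using xv iJ by (auto simp: Wi WJ)
    next
      case 4
      then show ?thesis using wu[OF 4] by (simp add: WJ sy xv xJ)
    qed
  qed
  ultimately show ?case by blast
qed

section \<open>Block Hankel matrices and quadrature\<close>

definition hankel :: "(nat \<Rightarrow> nat \<Rightarrow> nat \<Rightarrow> real) \<Rightarrow> nat \<times> nat \<Rightarrow> nat \<times> nat \<Rightarrow> real" where
  "hankel S = (\<lambda>(i, a) (j, b). S (i + j) a b)"

text \<open>
  If \<open>u\<close> holds the coefficients of the vector polynomial \<open>q\<close>, then
  \<open>d\<close> below holds those of \<open>(x - t) q\<close>; its degree is at most
  \<open>n\<close> because the last block of \<open>u\<close> vanishes. The hypothesis says that
  the Hankel matrix annihilates \<open>d\<close>, so \<open>(x - t) q = 0\<close> and, from the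
  top coefficient downwards, \<open>q = 0\<close>.
\<close>

lemma shift_pencil_kernel:
  fixes n p :: nat and S :: "nat \<Rightarrow> nat \<Rightarrow> nat \<Rightarrow> real" and u :: "nat \<times> nat \<Rightarrow> real"
  defines "I \<equiv> {..n} \<times> {..<p}"
  assumes pd: "posdef_on I (hankel S)"
    and last: "\<And>b. b < p \<Longrightarrow> u (n, b) = 0"
    and ker: "\<And>\<alpha>. \<alpha> \<in> I \<Longrightarrow> (\<Sum>\<beta>\<in>I. hankel (\<lambda>m. S (Suc m)) \<alpha> \<beta> * u \<beta>) = t * (\<Sum>\<beta>\<in>I. hankel S \<alpha> \<beta> * u \<beta>)"
    and "\<alpha> \<in> I"
  shows "u \<alpha> = 0"
proof -
  define v where "v = (\<lambda>(j, b). case j of 0 \<Rightarrow> 0 | Suc j' \<Rightarrow> u (j', b))"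
  define d where "d = (\<lambda>\<beta>. v \<beta> + (- t) * u \<beta>)"
  have "(\<Sum>\<beta>\<in>I. hankel S \<alpha> \<beta> * d \<beta>) = 0" if "\<alpha> \<in> I" for \<alpha>
  proof -
    obtain i a where \<alpha>: "\<alpha> = (i, a)" by force
    have "(\<Sum>\<beta>\<in>I. hankel S \<alpha> \<beta> * v \<beta>) = (\<Sum>j<Suc n. \<Sum>b<p. S (i + j) a b * v (j, b))"
      by (simp add: I_def hankel_def \<alpha> sum.cartesian_product lessThan_Suc_atMost case_prod_beta)
    also have "\<dots> = (\<Sum>j<n. \<Sum>b<p. S (Suc (i + j)) a b * u (j, b))"
      by (subst sum.lessThan_Suc_shift) (simp add: v_def)
    also have "\<dots> = (\<Sum>j<Suc n. \<Sum>b<p. S (Suc (i + j)) a b * u (j, b))"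
      using last by simp
    also have "\<dots> = (\<Sum>\<beta>\<in>I. hankel (\<lambda>m. S (Suc m)) \<alpha> \<beta> * u \<beta>)"
      by (simp add: I_def hankel_def \<alpha> sum.cartesian_product lessThan_Suc_atMost case_prod_beta)
    also have "\<dots> = t * (\<Sum>\<beta>\<in>I. hankel S \<alpha> \<beta> * u \<beta>)" using ker that .
    finally show ?thesis
      by (simp add: d_def algebra_simps sum.distrib sum_subtractf sum_distrib_left)
  qed
  then have "bform I (hankel S) d d = 0" by (simp add: bform_def)
  with pd have d0: "d \<beta> = 0" if "\<beta> \<in> I" for \<beta>
    using that unfolding posdef_on_def by (metis less_irrefl)
  have "u (n - k, b) = 0" if "k \<le> n" "b < p" for k b
    using that
  proof (induction k)
    case 0
    then show ?case using last by simp
  next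
    case (Suc k)
    from Suc.prems have "Suc (n - Suc k) = n - k" by simp
    then have "v (n - k, b) = u (n - Suc k, b)" by (auto simp: v_def split: nat.splits)
    moreover have "d (n - k, b) = 0" using Suc.prems by (intro d0) (auto simp: I_def)
    ultimately show ?case using Suc by (simp add: d_def)
  qed
  note * = this
  obtain i a where \<alpha>: "\<alpha> = (i, a)" by force
  show ?thesis using *[of "n - i" a] assms(5) by (auto simp: \<alpha> I_def)
qed

lemma hankel_sym:
  assumes "\<And>m a b. m \<le> 2 * n \<Longrightarrow> a < p \<Longrightarrow> b < p \<Longrightarrow> S m a b = S m b a"
  shows "sym_on ({..n} \<times> {..<p}) (hankel S)"
  using assms by (auto simp: sym_on_def hankel_def add.commute)

text \<open>
  With \<open>s\<close> times the identity as the new moment, suppose that every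
  \<open>s\<close> has a kernel vector. The symmetry of the part \<open>F\<close> of the pencil
  that is independent of \<open>s\<close> makes the last blocks for different \<open>s\<close>
  orthogonal, as for eigenvectors to different eigenvalues; they are nonzero, so \<open>p +
  1\<close> of them do not fit into dimension \<open>p\<close>.
\<close>

lemma regular_moment_extension:
  fixes n p :: nat and S :: "nat \<Rightarrow> nat \<Rightarrow> nat \<Rightarrow> real"
  defines "I \<equiv> {..n} \<times> {..<p}"
  assumes sym: "\<And>m a b. m \<le> 2 * n \<Longrightarrow> a < p \<Longrightarrow> b < p \<Longrightarrow> S m a b = S m b a"
    and pd: "posdef_on I (hankel S)"
  shows "\<exists>T. (\<forall>m\<le>2 * n. T m = S m) \<and> (\<forall>a b. T (Suc (2 * n)) a b = T (Suc (2 * n)) b a) \<and>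
    (\<forall>u. (\<forall>\<alpha>\<in>I. (\<Sum>\<beta>\<in>I. hankel (\<lambda>m. T (Suc m)) \<alpha> \<beta> * u \<beta>) = t * (\<Sum>\<beta>\<in>I. hankel T \<alpha> \<beta> * u \<beta>))
      \<longrightarrow> (\<forall>\<alpha>\<in>I. u \<alpha> = 0))"
proof (rule ccontr)
  assume contra: "\<not> ?thesis"
  define T where "T = (\<lambda>s. S(Suc (2 * n) := (\<lambda>a b. if a = b then s else (0 :: real))))"
  have T1: "T s m = S m" if "m \<le> 2 * n" for s m using that by (auto simp: T_def)
  have T2: "T s (Suc (2 * n)) a b = T s (Suc (2 * n)) b a" for s a b by (auto simp: T_def)
  have "\<forall>s. \<exists>u. (\<forall>\<alpha>\<in>I. (\<Sum>\<beta>\<in>I. hankel (\<lambda>m. T s (Suc m)) \<alpha> \<beta> * u \<beta>) = t * (\<Sum>\<beta>\<in>I. hankel (T s) \<alpha> \<beta> * u \<beta>))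
      \<and> (\<exists>\<alpha>\<in>I. u \<alpha> \<noteq> 0)"
    using contra T1 T2 by blast
  then obtain u where
    u: "\<And>s \<alpha>. \<alpha> \<in> I \<Longrightarrow> (\<Sum>\<beta>\<in>I. hankel (\<lambda>m. T s (Suc m)) \<alpha> \<beta> * u s \<beta>) = t * (\<Sum>\<beta>\<in>I. hankel (T s) \<alpha> \<beta> * u s \<beta>)"
    and unz: "\<And>s. \<exists>\<alpha>\<in>I. u s \<alpha> \<noteq> 0"
    by metis
  have hT: "hankel (T s) \<alpha> \<beta> = hankel S \<alpha> \<beta>" if "\<alpha> \<in> I" "\<beta> \<in> I" for s \<alpha> \<beta>
    using that by (auto simp: hankel_def I_def T1)
  have pdT: "posdef_on I (hankel (T s))" for s
    using pd hT by (simp add: posdef_on_def bform_def)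
  have nz: "\<exists>b\<in>{..<p}. u s (n, b) \<noteq> 0" for s
  proof (rule ccontr)
    assume "\<not> ?thesis"
    then have "\<And>b. b < p \<Longrightarrow> u s (n, b) = 0" by auto
    then have "u s \<alpha> = 0" if "\<alpha> \<in> I" for \<alpha>
      using shift_pencil_kernel[of n p "T s" "u s" t \<alpha>] pdT[of s] u[of _ s] that
      unfolding I_def by blast
    with unz show False by blast
  qed
  define F where "F = (\<lambda>\<alpha> \<beta>. hankel (\<lambda>m. T 0 (Suc m)) \<alpha> \<beta> - t * hankel S \<alpha> \<beta>)"
  have symF: "sym_on I F"
  proof -
    have "T 0 m a b = T 0 m b a" if "m \<le> Suc (2 * n)" "a < p" "b < p" for m a b
      using that sym[of m a b] T1[of m 0] T2[of 0 a b] by (cases "m = Suc (2 * n)") auto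
    then show ?thesis
      using sym by (auto simp: sym_on_def F_def hankel_def I_def add.commute)
  qed
  \<comment> \<open>Pairing the kernel equation for \<open>s\<close> with the kernel vector for \<open>r\<close>.\<close>
  have expand: "s * (\<Sum>b<p. u r (n, b) * u s (n, b)) = - bform I F (u r) (u s)" for r s
  proof -
    define P :: "nat \<times> nat \<Rightarrow> nat \<times> nat \<Rightarrow> real" where "P = (\<lambda>\<alpha> \<beta>. if fst \<alpha> = n \<and> \<alpha> = \<beta> then 1 else (0 :: real))"
    have hs: "hankel (\<lambda>m. T s (Suc m)) \<alpha> \<beta> = hankel (\<lambda>m. T 0 (Suc m)) \<alpha> \<beta> + s * P \<alpha> \<beta>"
      if "\<alpha> \<in> I" "\<beta> \<in> I" for \<alpha> \<beta>
      using that by (cases "fst \<alpha> = n \<and> fst \<beta> = n") (auto simp: hankel_def I_def T_def P_def split: if_splits)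
    have "(\<Sum>\<beta>\<in>I. F \<alpha> \<beta> * u s \<beta>) = - s * (\<Sum>\<beta>\<in>I. P \<alpha> \<beta> * u s \<beta>)" if "\<alpha> \<in> I" for \<alpha>
    proof -
      have "(\<Sum>\<beta>\<in>I. hankel (\<lambda>m. T s (Suc m)) \<alpha> \<beta> * u s \<beta>) = 
        (\<Sum>\<beta>\<in>I. hankel (\<lambda>m. T 0 (Suc m)) \<alpha> \<beta> * u s \<beta>) + s * (\<Sum>\<beta>\<in>I. P \<alpha> \<beta> * u s \<beta>)"
        using that by (simp add: hs algebra_simps sum.distrib sum_distrib_left)
      moreover have "(\<Sum>\<beta>\<in>I. hankel (T s) \<alpha> \<beta> * u s \<beta>) = (\<Sum>\<beta>\<in>I. hankel S \<alpha> \<beta> * u s \<beta>)"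
        using that by (simp add: hT)
      moreover have "(\<Sum>\<beta>\<in>I. F \<alpha> \<beta> * u s \<beta>) =
        (\<Sum>\<beta>\<in>I. hankel (\<lambda>m. T 0 (Suc m)) \<alpha> \<beta> * u s \<beta>) - t * (\<Sum>\<beta>\<in>I. hankel S \<alpha> \<beta> * u s \<beta>)"
        by (simp add: F_def left_diff_distrib sum_subtractf sum_distrib_left mult.assoc)
      ultimately show ?thesis using u[OF that, of s] by simp
    qed
    then have "bform I F (u r) (u s) = (\<Sum>\<alpha>\<in>I. u r \<alpha> * (- s * (\<Sum>\<beta>\<in>I. P \<alpha> \<beta> * u s \<beta>)))"
      by (simp add: bform_def)
    also have "\<dots> = (\<Sum>\<alpha>\<in>I. - s * (u r \<alpha> * (if fst \<alpha> = n then u s \<alpha> else 0)))"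
    proof (intro sum.cong refl)
      fix \<alpha> assume "\<alpha> \<in> I"
      moreover have "(\<Sum>\<beta>\<in>I. P \<alpha> \<beta> * u s \<beta>) = (\<Sum>\<beta>\<in>I. if \<beta> = \<alpha> then (if fst \<alpha> = n then u s \<alpha> else 0) else 0)"
        by (intro sum.cong) (auto simp: P_def)
      ultimately have "(\<Sum>\<beta>\<in>I. P \<alpha> \<beta> * u s \<beta>) = (if fst \<alpha> = n then u s \<alpha> else 0)"
        by (simp add: I_def)
      then show "u r \<alpha> * (- s * (\<Sum>\<beta>\<in>I. P \<alpha> \<beta> * u s \<beta>)) = - s * (u r \<alpha> * (if fst \<alpha> = n then u s \<alpha> else 0))"
        by simp
    qed
    also have "\<dots> = - s * (\<Sum>\<alpha>\<in>I. u r \<alpha> * (if fst \<alpha> = n then u s \<alpha> else 0))"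
      by (simp only: sum_distrib_left)
    also have "(\<Sum>\<alpha>\<in>I. u r \<alpha> * (if fst \<alpha> = n then u s \<alpha> else 0))
      = (\<Sum>j\<le>n. \<Sum>b<p. u r (j, b) * (if j = n then u s (j, b) else 0))"
      unfolding I_def sum.cartesian_product by (rule sum.cong) auto
    also have "\<dots> = (\<Sum>j\<le>n. if j = n then (\<Sum>b<p. u r (n, b) * u s (n, b)) else 0)"
      by (intro sum.cong) auto
    also have "\<dots> = (\<Sum>b<p. u r (n, b) * u s (n, b))" by simp
    finally show ?thesis by simp
  qed
  have "(\<Sum>b<p. u r (n, b) * u s (n, b)) = 0" if "r \<noteq> s" for r s
  proof -
    have "bform I F (u r) (u s) = bform I F (u s) (u r)" by (rule bform_commute[OF symF])
    moreover have "(\<Sum>b<p. u r (n, b) * u s (n, b)) = (\<Sum>b<p. u s (n, b) * u r (n, b))"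
      by (simp add: mult.commute)
    ultimately have "(s - r) * (\<Sum>b<p. u r (n, b) * u s (n, b)) = 0"
      using expand[of s r] expand[of r s] by (simp add: algebra_simps)
    with that show ?thesis by simp
  qed
  then have "card {..p} \<le> card {..<p}"
    using nz by (intro card_orthogonal_le[of _ _ "\<lambda>k b. u (real k) (n, b)"]) auto
  then show False by simp
qed

text \<open>
  The nodes \<open>l\<close> and the vectors \<open>c\<close> are the eigenvalues and the first
  blocks of the vectors that diagonalize the Hankel matrix and its shift simultaneously.
\<close>

lemma quadrature_avoiding_point:
  fixes n p :: nat and S :: "nat \<Rightarrow> nat \<Rightarrow> nat \<Rightarrow> real"
  defines "I \<equiv> {..n} \<times> {..<p}"
  assumes sym: "\<And>m a b. m \<le> 2 * n \<Longrightarrow> a < p \<Longrightarrow> b < p \<Longrightarrow> S m a b = S m b a"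
    and pd: "posdef_on I (hankel S)"
  shows "\<exists>c l. (\<forall>k\<in>I. l k \<noteq> t) \<and> (\<forall>k\<in>I. \<exists>a<p. c k a \<noteq> 0) \<and>
    (\<forall>m\<le>2 * n. \<forall>a<p. \<forall>b<p. S m a b = (\<Sum>k\<in>I. l k ^ m * c k a * c k b))"
proof -
  have fin: "finite I" by (simp add: I_def)
  have "\<exists>T. (\<forall>m\<le>2 * n. T m = S m) \<and> (\<forall>a b. T (Suc (2 * n)) a b = T (Suc (2 * n)) b a) \<and>
    (\<forall>u. (\<forall>\<alpha>\<in>I. (\<Sum>\<beta>\<in>I. hankel (\<lambda>m. T (Suc m)) \<alpha> \<beta> * u \<beta>) = t * (\<Sum>\<beta>\<in>I. hankel T \<alpha> \<beta> * u \<beta>))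
      \<longrightarrow> (\<forall>\<alpha>\<in>I. u \<alpha> = 0))"
    using pd unfolding I_def by (intro regular_moment_extension) (auto intro: sym)
  then obtain T where T1: "\<And>m. m \<le> 2 * n \<Longrightarrow> T m = S m"
    and T2: "\<And>a b. T (Suc (2 * n)) a b = T (Suc (2 * n)) b a"
    and T3: "\<forall>u. (\<forall>\<alpha>\<in>I. (\<Sum>\<beta>\<in>I. hankel (\<lambda>m. T (Suc m)) \<alpha> \<beta> * u \<beta>) = t * (\<Sum>\<beta>\<in>I. hankel T \<alpha> \<beta> * u \<beta>))
      \<longrightarrow> (\<forall>\<alpha>\<in>I. u \<alpha> = 0)"
    by blast
  have symT: "T m a b = T m b a" if "m \<le> Suc (2 * n)" "a < p" "b < p" for m a b
    using that sym[of m a b] T1[of m] T2[of a b] by (cases "m = Suc (2 * n)") auto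
  define M where "M = hankel T"
  define H where "H = hankel (\<lambda>m. T (Suc m))"
  have "sym_on I M" "sym_on I H"
    unfolding M_def H_def I_def using symT by (auto intro!: hankel_sym)
  moreover have "posdef_on I M"
  proof -
    have "M \<alpha> \<beta> = hankel S \<alpha> \<beta>" if "\<alpha> \<in> I" "\<beta> \<in> I" for \<alpha> \<beta>
      using that by (auto simp: M_def hankel_def I_def T1)
    with pd show ?thesis by (simp add: posdef_on_def bform_def)
  qed
  ultimately obtain w u l
    where wM: "\<And>\<alpha> \<beta>. \<alpha> \<in> I \<Longrightarrow> \<beta> \<in> I \<Longrightarrow> M \<alpha> \<beta> = (\<Sum>k\<in>I. w k \<alpha> * w k \<beta>)"
      and wH: "\<And>\<alpha> \<beta>. \<alpha> \<in> I \<Longrightarrow> \<beta> \<in> I \<Longrightarrow> H \<alpha> \<beta> = (\<Sum>k\<in>I. l k * w k \<alpha> * w k \<beta>)"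
      and wu: "\<And>k m. k \<in> I \<Longrightarrow> m \<in> I \<Longrightarrow> (\<Sum>\<alpha>\<in>I. w k \<alpha> * u m \<alpha>) = (if k = m then 1 else 0)"
    using simultaneous_diagonalization[OF fin, of M H] by blast
  \<comment> \<open>Pairing a combination of the vectors \<open>w k\<close> with the dual vector \<open>u m\<close> isolates its coefficient \<open>y m\<close>.\<close>
  have inj: "y m = 0" if m: "m \<in> I" and y: "\<And>\<alpha>. \<alpha> \<in> I \<Longrightarrow> (\<Sum>k\<in>I. w k \<alpha> * y k) = 0" for y m
  proof -
    have "0 = (\<Sum>\<alpha>\<in>I. (\<Sum>k\<in>I. w k \<alpha> * y k) * u m \<alpha>)" using y by simp
    also have "\<dots> = (\<Sum>k\<in>I. y k * (\<Sum>\<alpha>\<in>I. w k \<alpha> * u m \<alpha>))"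
      by (simp add: sum_distrib_right sum_distrib_left mult_ac) (rule sum.swap)
    also have "\<dots> = (\<Sum>k\<in>I. if k = m then y m else 0)"
      using m by (intro sum.cong) (auto simp: wu)
    also have "\<dots> = y m" using m fin by simp
    finally show ?thesis by simp
  qed
  have step: "w k (Suc j, b) = l k * w k (j, b)" if "k \<in> I" "j < n" "b < p" for k j b
  proof -
    have "(\<Sum>k\<in>I. w k \<alpha> * (w k (Suc j, b) - l k * w k (j, b))) = 0" if "\<alpha> \<in> I" for \<alpha>
    proof -
      have *: "(Suc j, b) \<in> I" "(j, b) \<in> I" using \<open>j < n\<close> \<open>b < p\<close> by (auto simp: I_def)
      have "(\<Sum>k\<in>I. w k \<alpha> * (w k (Suc j, b) - l k * w k (j, b))) = M \<alpha> (Suc j, b) - H \<alpha> (j, b)"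
        using that * by (simp add: wM wH algebra_simps sum_subtractf)
      also have "\<dots> = 0" by (simp add: M_def H_def hankel_def case_prod_beta)
      finally show ?thesis .
    qed
    from inj[OF that(1) this] show ?thesis by simp
  qed
  define c where "c = (\<lambda>k a. w k (0, a))"
  have pow: "w k (j, b) = l k ^ j * c k b" if "k \<in> I" "j \<le> n" "b < p" for k j b
    using that by (induction j) (auto simp: step c_def)
  \<comment> \<open>Otherwise the dual vector \<open>u k\<close> would be a kernel vector of the pencil at \<open>t\<close>.\<close>
  have "l k \<noteq> t" if k: "k \<in> I" for k
  proof
    assume lk: "l k = t"
    have "\<forall>\<alpha>\<in>I. u k \<alpha> = 0"
    proof (rule spec[OF T3, THEN mp], intro ballI)
      fix \<alpha> assume \<alpha>: "\<alpha> \<in> I"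
      have gen: "(\<Sum>\<beta>\<in>I. (\<Sum>m\<in>I. d m * w m \<alpha> * w m \<beta>) * u k \<beta>) = d k * w k \<alpha>" for d
      proof -
        have "(\<Sum>\<beta>\<in>I. (\<Sum>m\<in>I. d m * w m \<alpha> * w m \<beta>) * u k \<beta>) = (\<Sum>m\<in>I. d m * w m \<alpha> * (\<Sum>\<beta>\<in>I. w m \<beta> * u k \<beta>))"
          by (simp add: sum_distrib_right sum_distrib_left mult.assoc) (rule sum.swap)
        also have "\<dots> = (\<Sum>m\<in>I. if m = k then d k * w k \<alpha> else 0)"
          using k by (intro sum.cong) (auto simp: wu)
        finally show ?thesis using k fin by simp
      qed
      have "(\<Sum>\<beta>\<in>I. M \<alpha> \<beta> * u k \<beta>) = w k \<alpha>"
        using gen[of "\<lambda>_. 1"] \<alpha> by (simp add: wM)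
      moreover have "(\<Sum>\<beta>\<in>I. H \<alpha> \<beta> * u k \<beta>) = l k * w k \<alpha>"
        using gen[of l] \<alpha> by (simp add: wH)
      ultimately show "(\<Sum>\<beta>\<in>I. hankel (\<lambda>m. T (Suc m)) \<alpha> \<beta> * u k \<beta>) = t * (\<Sum>\<beta>\<in>I. hankel T \<alpha> \<beta> * u k \<beta>)"
        by (simp add: M_def H_def lk)
    qed
    with wu[OF k k] show False by simp
  qed
  moreover have "\<exists>a<p. c k a \<noteq> 0" if "k \<in> I" for k
  proof (rule ccontr)
    assume "\<not> ?thesis"
    then have "w k \<alpha> = 0" if "\<alpha> \<in> I" for \<alpha>
      using that pow[OF \<open>k \<in> I\<close>] by (auto simp: I_def)
    with wu[OF that that] show False by simp
  qed
  moreover have "S m a b = (\<Sum>k\<in>I. l k ^ m * c k a * c k b)" if m: "m \<le> 2 * n" and ab: "a < p" "b < p" for m a b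
  proof -
    define i where "i = min m n"
    define j where "j = m - i"
    have ij: "i \<le> n" "j \<le> n" "m = i + j" using m by (auto simp: i_def j_def)
    then have "S m a b = M (i, a) (j, b)" using m by (simp add: M_def hankel_def T1)
    also have "\<dots> = (\<Sum>k\<in>I. w k (i, a) * w k (j, b))"
      using ij ab by (intro wM) (auto simp: I_def)
    also have "\<dots> = (\<Sum>k\<in>I. l k ^ m * c k a * c k b)"
      using ij ab by (intro sum.cong refl) (simp add: pow power_add)
    finally show ?thesis .
  qed
  ultimately show ?thesis by blast
qed

section \<open>Rank and sums of products\<close>

text \<open>
  A basis of the column space chosen among the columns cannot have more than \<open>card
  K\<close> elements, because the vectors of coefficients \<open>d\<close> that belong to these
  columns would satisfy a linear relation.
\<close>

lemma rank_le_card_products: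
  fixes A :: "real mat" and c :: "'k \<Rightarrow> nat \<Rightarrow> real"
  assumes A: "A \<in> carrier_mat p q" and "finite K"
    and prod: "\<And>a b. a < p \<Longrightarrow> b < q \<Longrightarrow> A $$ (a, b) = (\<Sum>k\<in>K. c k a * d k b)"
  shows "mat_rank p A \<le> card K"
proof (rule ccontr)
  interpret vec_space "TYPE(real)" p .
  assume "\<not> mat_rank p A \<le> card K"
  obtain S where S: "maximal S (\<lambda>T. T \<subseteq> set (cols A) \<and> lin_indpt T)"
    using maximal_exists_superset[of "set (cols A)" "\<lambda>T. T \<subseteq> set (cols A) \<and> lin_indpt T" "{}"]
    by (auto simp: lin_dep_def)
  then have S1: "S \<subseteq> set (cols A)" "lin_indpt S" by (auto simp: maximal_def)
  then have finS: "finite S" by (meson List.finite_set finite_subset)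
  have "\<forall>s\<in>S. \<exists>b<q. s = col A b"
    using S1(1) A by (auto simp: cols_def dest!: subsetD)
  then obtain \<beta> where \<beta>: "\<And>s. s \<in> S \<Longrightarrow> \<beta> s < q \<and> s = col A (\<beta> s)" by metis
  have "card K < card S"
    using rank_card_indpt[OF A S] \<open>\<not> mat_rank p A \<le> card K\<close> by simp
  from nontrivial_kernel[OF assms(2) finS this, of "\<lambda>k s. d k (\<beta> s)"]
  obtain y s where y: "s \<in> S" "y s \<noteq> 0" "\<And>k. k \<in> K \<Longrightarrow> (\<Sum>s\<in>S. y s * d k (\<beta> s)) = 0"
    by blast
  have Sc: "S \<subseteq> carrier_vec p" using S1(1) A cols_dim[of A] by auto
  have "lincomb y S = 0\<^sub>v p"
  proof (rule eq_vecI)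
    fix a assume "a < dim_vec (0\<^sub>v p :: real vec)"
    then have a: "a < p" by simp
    have "lincomb y S $ a = (\<Sum>s\<in>S. y s * s $ a)"
      using lincomb_index[OF a Sc] .
    also have "\<dots> = (\<Sum>s\<in>S. y s * (\<Sum>k\<in>K. c k a * d k (\<beta> s)))"
    proof (intro sum.cong refl)
      fix s assume "s \<in> S"
      with \<beta> have b: "\<beta> s < q" and s: "s = col A (\<beta> s)" by auto
      have "s $ a = A $$ (a, \<beta> s)" using b A a by (subst s) simp
      then show "y s * s $ a = y s * (\<Sum>k\<in>K. c k a * d k (\<beta> s))" using prod[OF a b] by simp
    qed
    also have "\<dots> = (\<Sum>k\<in>K. c k a * (\<Sum>s\<in>S. y s * d k (\<beta> s)))"
      by (simp add: sum_distrib_left mult_ac) (rule sum.swap)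
    also have "\<dots> = 0" using y(3) by simp
    finally show "lincomb y S $ a = 0\<^sub>v p $ a" using a by simp
  qed (use lincomb_dim[OF finS Sc] in simp)
  then have "lin_dep S"
    using lin_dep_crit[OF finS, where S = S and a = y and v = s] y(1,2) by auto
  with S1(2) show False by blast
qed

text \<open>
  The vectors \<open>c r\<close> are a basis of the column space chosen among the columns, and
  \<open>d r b\<close> are the coordinates of column \<open>b\<close>.
\<close>

lemma rank_factorization:
  fixes A :: "real mat"
  assumes A: "A \<in> carrier_mat p q"
  shows "\<exists>(c :: nat \<Rightarrow> nat \<Rightarrow> real) d. \<forall>a<p. \<forall>b<q. A $$ (a, b) = (\<Sum>r<mat_rank p A. c r a * d r b)"
proof -
  interpret vec_space "TYPE(real)" p .
  obtain S where S: "maximal S (\<lambda>T. T \<subseteq> set (cols A) \<and> lin_indpt T)"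
    using maximal_exists_superset[of "set (cols A)" "\<lambda>T. T \<subseteq> set (cols A) \<and> lin_indpt T" "{}"]
    by (auto simp: lin_dep_def)
  then have S1: "S \<subseteq> set (cols A)" "lin_indpt S" by (auto simp: maximal_def)
  have max: "T = S" if "S \<subseteq> T" "T \<subseteq> set (cols A)" "lin_indpt T" for T
    using S that unfolding maximal_def by auto
  have finS: "finite S" using S1 by (meson List.finite_set finite_subset)
  have colsc: "set (cols A) \<subseteq> carrier_vec p" using A cols_dim[of A] by auto
  with S1 have Sc: "S \<subseteq> carrier_vec p" by auto
  have "\<exists>y. lincomb y S = col A b" if b: "b < q" for b
  proof -
    have cA: "col A b \<in> set (cols A)" using b A by (auto simp: cols_def)
    have "col A b \<in> span S"
    proof (cases "col A b \<in> S")
      case True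
      then show ?thesis using Sc span_mem[of S "col A b"] by auto
    next
      case False
      with max[of "S \<union> {col A b}"] cA S1(1) have "lin_dep (S \<union> {col A b})" by auto
      then show ?thesis
        using lin_dep_iff_in_span[OF _ S1(2) _ False] Sc cA colsc by auto
    qed
    then show ?thesis using finite_in_span[OF finS] Sc by auto
  qed
  then obtain y where y: "\<And>b. b < q \<Longrightarrow> lincomb (y b) S = col A b" by metis
  have "card S = mat_rank p A" using rank_card_indpt[OF A S] by simp
  with ex_bij_betw_nat_finite[OF finS] obtain h where h: "bij_betw h {..<mat_rank p A} S"
    by (auto simp: atLeast0LessThan)
  have "A $$ (a, b) = (\<Sum>r<mat_rank p A. h r $ a * y b (h r))" if "a < p" "b < q" for a b
  proof -
    have "A $$ (a, b) = col A b $ a" using that A by simp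
    also have "\<dots> = (\<Sum>s\<in>S. y b s * s $ a)"
      unfolding y[OF that(2), symmetric] by (rule lincomb_index[OF that(1) Sc])
    also have "\<dots> = (\<Sum>r<mat_rank p A. y b (h r) * h r $ a)"
      by (rule sum.reindex_bij_betw[OF h, symmetric])
    finally show ?thesis by (simp add: mult.commute)
  qed
  then show ?thesis
    by (intro exI[of _ "\<lambda>r a. h r $ a"] exI[of _ "\<lambda>r b. y b (h r)"]) auto
qed

text \<open>
  Rank factorizations of the \<open>A j\<close> write \<open>M\<close> as a sum of as many
  products as the right-hand side says. Were there fewer of them than indices, a nonzero vector
  would be annihilated by all right factors, hence by \<open>M\<close>. The functions
  \<open>v\<close> and \<open>e\<close> stand for the powers of the nodes and the position
  within a block.
\<close>

lemma posdef_card_le_rank_sum: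
  fixes M :: "'i \<Rightarrow> 'i \<Rightarrow> real" and N :: nat
  assumes "finite I" and pd: "posdef_on I M"
    and A: "\<And>j. j < N \<Longrightarrow> A j \<in> carrier_mat p p"
    and M: "\<And>\<alpha> \<beta>. \<alpha> \<in> I \<Longrightarrow> \<beta> \<in> I \<Longrightarrow> M \<alpha> \<beta> = (\<Sum>j<N. v j \<alpha> * v j \<beta> * A j $$ (e \<alpha>, e \<beta>))"
    and e: "\<And>\<alpha>. \<alpha> \<in> I \<Longrightarrow> e \<alpha> < p"
  shows "card I \<le> (\<Sum>j<N. mat_rank p (A j))"
proof (rule ccontr)
  have "\<exists>c d. \<forall>j<N. \<forall>a<p. \<forall>b<p. A j $$ (a, b) = (\<Sum>r<mat_rank p (A j). c j r a * d j r b)"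
    using rank_factorization[OF A] by metis
  then obtain c d where fac: "\<And>j a b. j < N \<Longrightarrow> a < p \<Longrightarrow> b < p \<Longrightarrow>
      A j $$ (a, b) = (\<Sum>r<mat_rank p (A j). c j r a * d j r b)" by metis
  define K where "K = (SIGMA j:{..<N}. {..<mat_rank p (A j)})"
  have finK: "finite K" unfolding K_def by (rule finite_SigmaI) auto
  assume "\<not> ?thesis"
  moreover have "card K = (\<Sum>j<N. mat_rank p (A j))" by (simp add: K_def)
  ultimately have "card K < card I" by simp
  from nontrivial_kernel[OF finK assms(1) this, of "\<lambda>(j, r) \<beta>. v j \<beta> * d j r (e \<beta>)"]
  obtain y where y: "\<exists>\<beta>\<in>I. y \<beta> \<noteq> 0"
    "\<forall>k\<in>K. (\<Sum>\<beta>\<in>I. y \<beta> * (case k of (j, r) \<Rightarrow> \<lambda>\<beta>. v j \<beta> * d j r (e \<beta>)) \<beta>) = 0"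
    by blast
  then have y2: "(\<Sum>\<beta>\<in>I. y \<beta> * (v j \<beta> * d j r (e \<beta>))) = 0" if "j < N" "r < mat_rank p (A j)" for j r
    using that by (auto simp: K_def)
  have "(\<Sum>\<beta>\<in>I. M \<alpha> \<beta> * y \<beta>) = 0" if "\<alpha> \<in> I" for \<alpha>
  proof -
    have "(\<Sum>\<beta>\<in>I. M \<alpha> \<beta> * y \<beta>) =
      (\<Sum>\<beta>\<in>I. \<Sum>j<N. \<Sum>r<mat_rank p (A j). v j \<alpha> * c j r (e \<alpha>) * (y \<beta> * (v j \<beta> * d j r (e \<beta>))))"
      using that e by (intro sum.cong refl)
        (simp add: M fac sum_distrib_right sum_distrib_left mult_ac)
    also have "\<dots> = (\<Sum>j<N. \<Sum>r<mat_rank p (A j). \<Sum>\<beta>\<in>I. v j \<alpha> * c j r (e \<alpha>) * (y \<beta> * (v j \<beta> * d j r (e \<beta>))))"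
      by (subst sum.swap) (intro sum.cong refl sum.swap)
    also have "\<dots> = (\<Sum>j<N. \<Sum>r<mat_rank p (A j). v j \<alpha> * c j r (e \<alpha>) * (\<Sum>\<beta>\<in>I. y \<beta> * (v j \<beta> * d j r (e \<beta>))))"
      by (simp add: sum_distrib_left)
    also have "\<dots> = 0"
      by (intro sum.neutral ballI) (simp only: lessThan_iff y2 mult_zero_right)
    finally show ?thesis .
  qed
  then have "bform I M y y = 0" by (simp add: bform_def)
  with pd y(1) show False unfolding posdef_on_def by (metis less_irrefl)
qed

section \<open>Integration against finitely atomic matrix measures\<close>

definition discrete_measure :: "nat \<Rightarrow> (nat \<Rightarrow> real) \<Rightarrow> (nat \<Rightarrow> real) \<Rightarrow> real measure" where
  "discrete_measure N c x = distr (point_measure {..<N} (\<lambda>j. ennreal (c j))) borel x"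

lemma emeasure_discrete_measure:
  assumes "\<And>j. j < N \<Longrightarrow> c j \<ge> 0" "B \<in> sets borel"
  shows "emeasure (discrete_measure N c x) B = ennreal (\<Sum>j<N. c j * indicat_real B (x j))"
proof -
  have "emeasure (discrete_measure N c x) B =
    emeasure (point_measure {..<N} (\<lambda>j. ennreal (c j))) (x -` B \<inter> {..<N})"
    using assms(2) unfolding discrete_measure_def
    by (subst emeasure_distr) (auto simp: space_point_measure)
  also have "\<dots> = (\<Sum>j\<in>x -` B \<inter> {..<N}. ennreal (c j))"
    by (rule emeasure_point_measure_finite) auto
  also have "\<dots> = ennreal (\<Sum>j\<in>x -` B \<inter> {..<N}. c j)"
    using assms(1) by (intro sum_ennreal) auto
  also have "(\<Sum>j\<in>x -` B \<inter> {..<N}. c j) = (\<Sum>j<N. c j * indicat_real B (x j))"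
    by (intro sum.mono_neutral_cong_left) (auto simp: indicator_def)
  finally show ?thesis .
qed

text \<open>
  Upper variations and trace measures are built by \<open>measure_of\<close> from explicit set
  functions; for atomic matrix measures these functions agree with a
  \<open>discrete_measure\<close> on the Borel sets, and then so do the measures.
\<close>

lemma measure_of_discrete:
  assumes "\<And>j. j < N \<Longrightarrow> c j \<ge> 0"
    and "\<And>B. B \<in> sets borel \<Longrightarrow> f B = ennreal (\<Sum>j<N. c j * indicat_real B (x j))"
  shows "measure_of UNIV (sets borel) f = discrete_measure N c x"
proof -
  have *: "sigma_sets UNIV (sets borel) = sets (borel :: real measure)"
    using sets.sigma_sets_eq[of "borel :: real measure"] by simp
  have "measure_of UNIV (sets borel) f = measure_of UNIV (sets borel) (emeasure (discrete_measure N c x))"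
    by (rule measure_of_eq) (auto simp: * emeasure_discrete_measure assms)
  also have "\<dots> = discrete_measure N c x"
    using measure_of_of_measure[of "discrete_measure N c x"] by (simp add: discrete_measure_def)
  finally show ?thesis .
qed

lemma discrete_measure_integrable:
  assumes "\<And>j. j < N \<Longrightarrow> c j \<ge> 0" "f \<in> borel_measurable borel"
  shows "integrable (discrete_measure N c x) (f :: real \<Rightarrow> real)"
  using assms unfolding discrete_measure_def
  by (subst integrable_distr_eq) (auto intro: integrable_point_measure_finite)

lemma discrete_measure_integral:
  assumes "\<And>j. j < N \<Longrightarrow> c j \<ge> 0" "f \<in> borel_measurable borel"
  shows "(LINT y|discrete_measure N c x. f y) = (\<Sum>j<N. c j * (f (x j) :: real))"
proof -
  have "(LINT y|discrete_measure N c x. f y) = (LINT j|point_measure {..<N} (\<lambda>j. ennreal (c j)). f (x j))"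
    unfolding discrete_measure_def using assms(2) by (intro integral_distr) auto
  also have "\<dots> = (\<Sum>j<N. c j *\<^sub>R f (x j))"
    by (rule lebesgue_integral_point_measure_finite) (auto simp: assms(1))
  finally show ?thesis by simp
qed

text \<open>
  The supremum is attained at the set of the points in \<open>A\<close> with positive weight;
  that no positive weight shares its point with a negative one is where injectivity of
  \<open>x\<close> enters.
\<close>

lemma upper_variation_discrete:
  assumes inj: "inj_on x {..<N}"
    and \<nu>: "\<And>B. B \<in> sets borel \<Longrightarrow> \<nu> B = (\<Sum>j<N. c j * indicat_real B (x j))"
  shows "upper_variation \<nu> = discrete_measure N (\<lambda>j. max (c j) 0) x"
  unfolding upper_variation_def
proof (rule measure_of_discrete)
  fix A :: "real set" assume A: "A \<in> sets borel"
  show "(SUP B\<in>{B \<in> sets borel. B \<subseteq> A}. ennreal (\<nu> B)) =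
    ennreal (\<Sum>j<N. max (c j) 0 * indicat_real A (x j))" (is "?S = ennreal ?R")
  proof (rule antisym)
    show "?S \<le> ennreal ?R"
    proof (intro SUP_least ennreal_leI)
      fix B assume "B \<in> {B \<in> sets borel. B \<subseteq> A}"
      then have B: "B \<in> sets borel" "B \<subseteq> A" by auto
      show "\<nu> B \<le> ?R"
        unfolding \<nu>[OF B(1)] by (rule sum_mono) (use B(2) in \<open>auto simp: indicator_def\<close>)
    qed
    define P where "P = A \<inter> x ` {j. j < N \<and> c j > 0}"
    have "finite (x ` {j. j < N \<and> c j > 0})" by simp
    then have P: "P \<in> sets borel" "P \<subseteq> A"
      using A by (auto simp: P_def intro!: sets.Int borel_closed finite_imp_closed)
    have "c j * indicat_real P (x j) = max (c j) 0 * indicat_real A (x j)" if "j < N" for j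
    proof -
      have "x j \<in> P \<longleftrightarrow> x j \<in> A \<and> c j > 0"
        using inj that by (auto simp: P_def inj_on_def)
      then show ?thesis by (auto simp: indicator_def max_def)
    qed
    then have "\<nu> P = ?R" using P by (simp add: \<nu>)
    then have "ennreal ?R = ennreal (\<nu> P)" by simp
    also have "\<dots> \<le> ?S" using P by (intro SUP_upper) auto
    finally show "ennreal ?R \<le> ?S" .
  qed
qed auto

lemma signed_integral_discrete:
  fixes N :: nat
  assumes inj: "inj_on x {..<N}"
    and \<nu>: "\<And>B. B \<in> sets borel \<Longrightarrow> \<nu> B = (\<Sum>j<N. c j * indicat_real B (x j))"
    and f: "f \<in> borel_measurable borel"
  shows "signed_integral \<nu> f = (\<Sum>j<N. c j * f (x j))"
proof -
  have "upper_variation (\<lambda>B. - \<nu> B) = discrete_measure N (\<lambda>j. max (- c j) 0) x"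
    by (rule upper_variation_discrete[OF inj]) (simp add: \<nu> sum_negf)
  moreover have "upper_variation \<nu> = discrete_measure N (\<lambda>j. max (c j) 0) x"
    by (rule upper_variation_discrete[OF inj]) (simp add: \<nu>)
  ultimately have "signed_integral \<nu> f = (\<Sum>j<N. max (c j) 0 * f (x j)) - (\<Sum>j<N. max (- c j) 0 * f (x j))"
    by (simp add: signed_integral_def discrete_measure_integral f)
  also have "\<dots> = (\<Sum>j<N. c j * f (x j))"
    unfolding sum_subtractf[symmetric] by (intro sum.cong) (auto simp: max_def)
  finally show ?thesis .
qed

lemma signed_measure_discrete:
  fixes N :: nat
  assumes \<nu>: "\<And>B. B \<in> sets borel \<Longrightarrow> \<nu> B = (\<Sum>j<N. c j * indicat_real B (x j))"
  shows "signed_measure \<nu>"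
  unfolding signed_measure_def
proof (intro conjI allI impI)
  show "\<nu> {} = 0" by (simp add: \<nu>)
next
  fix B :: "nat \<Rightarrow> real set"
  assume B: "range B \<subseteq> sets borel" and disj: "disjoint_family B"
  have "(\<lambda>k. \<Sum>j<N. c j * indicat_real (B k) (x j)) sums (\<Sum>j<N. c j * indicat_real (\<Union>k. B k) (x j))"
    using disj by (intro sums_sum sums_mult indicator_sums) (auto simp: disjoint_family_on_def)
  moreover have "(\<Union>k. B k) \<in> sets borel" using B by auto
  moreover have "\<nu> (B k) = (\<Sum>j<N. c j * indicat_real (B k) (x j))" for k
    using B by (intro \<nu>) auto
  ultimately show "(\<lambda>k. \<nu> (B k)) sums \<nu> (\<Union>k. B k)" by (simp add: \<nu>)
qed

lemma quadratic_form_sum: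
  assumes "A \<in> carrier_mat p p" "v \<in> carrier_vec p"
  shows "scalar_prod v (A *\<^sub>v v) = (\<Sum>a<p. \<Sum>b<p. v $ a * A $$ (a, b) * v $ b)"
  using assms by (auto simp: scalar_prod_def mult_mat_vec_def sum_distrib_left atLeast0LessThan mult.assoc
      intro!: sum.cong)

lemma pos_semidef_sum:
  fixes N :: nat
  assumes A: "\<And>j. j < N \<Longrightarrow> pos_semidef p (A j)" and c: "\<And>j. j < N \<Longrightarrow> c j \<ge> 0"
  shows "pos_semidef p (Matrix.mat p p (\<lambda>(a, b). \<Sum>j<N. A j $$ (a, b) * c j))" (is "pos_semidef p ?B")
proof -
  have carr: "A j \<in> carrier_mat p p" and symj: "transpose_mat (A j) = A j" if "j < N" for j
    using A[OF that] by (auto simp: pos_semidef_def sym_mats_def)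
  have sym: "A j $$ (a, b) = A j $$ (b, a)" if "j < N" "a < p" "b < p" for j a b
    using symj[OF that(1)] carr[OF that(1)] that by (metis carrier_matD index_transpose_mat(1))
  have "?B \<in> sym_mats p"
    using sym by (auto simp: sym_mats_def intro!: eq_matI sum.cong)
  moreover have "scalar_prod v (?B *\<^sub>v v) \<ge> 0" if v: "v \<in> carrier_vec p" for v
  proof -
    have "scalar_prod v (?B *\<^sub>v v) = (\<Sum>a<p. \<Sum>b<p. \<Sum>j<N. c j * (v $ a * A j $$ (a, b) * v $ b))"
      using v by (subst quadratic_form_sum[of _ p])
        (auto simp: sum_distrib_left sum_distrib_right mult_ac intro!: sum.cong)
    also have "\<dots> = (\<Sum>j<N. \<Sum>a<p. \<Sum>b<p. c j * (v $ a * A j $$ (a, b) * v $ b))"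
      by (subst (2) sum.swap) (subst sum.swap, intro sum.cong refl)
    also have "\<dots> = (\<Sum>j<N. c j * scalar_prod v (A j *\<^sub>v v))"
      using v carr by (intro sum.cong refl) (simp add: quadratic_form_sum[of _ p] sum_distrib_left)
    also have "\<dots> \<ge> 0"
      using A c v by (intro sum_nonneg mult_nonneg_nonneg) (auto simp: pos_semidef_def)
    finally show ?thesis .
  qed
  ultimately show ?thesis by (simp add: pos_semidef_def)
qed

lemma pos_semidef_diag_nonneg:
  assumes "pos_semidef p A" "i < p" shows "A $$ (i, i) \<ge> 0"
proof -
  have A: "A \<in> carrier_mat p p" using assms by (auto simp: pos_semidef_def sym_mats_def)
  have "A $$ (i, i) = scalar_prod (unit_vec p i) (A *\<^sub>v unit_vec p i)"
    using A assms(2) by (simp add: scalar_prod_left_unit mult_mat_vec_def scalar_prod_right_unit)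
  then show ?thesis using assms by (auto simp: pos_semidef_def)
qed

text \<open>
  All measure theory ends here: for atomic measures, integrals of polynomials are finite sums,
  and positivity and integrability hold automatically.
\<close>

lemma atomic_representing_measure_iff:
  assumes at: "atomic_form p \<mu> N A x"
  shows "representing_measure p d L \<mu> \<longleftrightarrow>
    (\<forall>q. degree q \<le> d \<longrightarrow> L q = Matrix.mat p p (\<lambda>(a, b). \<Sum>j<N. A j $$ (a, b) * poly q (x j)))"
proof -
  have psd: "pos_semidef p (A j)" if "j < N" for j using at that by (simp add: atomic_form_def)
  have inj: "inj_on x {..<N}" using at by (simp add: atomic_form_def)
  have \<mu>: "\<mu> B = Matrix.mat p p (\<lambda>(a, b). \<Sum>j<N. A j $$ (a, b) * indicat_real B (x j))"
    if "B \<in> sets borel" for B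
    using at that by (simp add: atomic_form_def)
  have "pos_matrix_measure p \<mu>"
    unfolding pos_matrix_measure_def
  proof (intro conjI allI impI ballI)
    fix i j assume "i < p" "j < p"
    then show "signed_measure (\<lambda>B. \<mu> B $$ (i, j))"
      by (intro signed_measure_discrete[where N = N and c = "\<lambda>k. A k $$ (i, j)" and x = x]) (simp add: \<mu>)
  next
    fix B :: "real set" assume "B \<in> sets borel"
    show "pos_semidef p (\<mu> B)"
      unfolding \<mu>[OF \<open>B \<in> sets borel\<close>] by (rule pos_semidef_sum) (auto simp: psd)
  qed
  moreover have "matrix_integral p \<mu> (poly q) =
      Matrix.mat p p (\<lambda>(a, b). \<Sum>j<N. A j $$ (a, b) * poly q (x j))" for q
    unfolding matrix_integral_def
  proof (rule cong_mat, goal_cases)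
    case (3 i j)
    have "signed_integral (\<lambda>B. \<mu> B $$ (i, j)) (poly q) = (\<Sum>k<N. A k $$ (i, j) * poly q (x k))"
      using 3 by (intro signed_integral_discrete[OF inj]) (auto simp: \<mu> intro!: borel_measurable_continuous_onI continuous_intros)
    then show ?case by simp
  qed auto
  moreover have "integrable (trace_measure p \<mu>) (poly q)" for q
  proof -
    have nn: "(\<Sum>i<p. A j $$ (i, i)) \<ge> 0" if "j < N" for j
      using pos_semidef_diag_nonneg[OF psd[OF that]] by (intro sum_nonneg) auto
    have "trace_measure p \<mu> = discrete_measure N (\<lambda>j. \<Sum>i<p. A j $$ (i, i)) x"
      unfolding trace_measure_def
    proof (rule measure_of_discrete[OF nn])
      fix B :: "real set" assume "B \<in> sets borel"
      then have "(\<Sum>i<p. \<mu> B $$ (i, i)) = (\<Sum>i<p. \<Sum>j<N. A j $$ (i, i) * indicat_real B (x j))"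
        by (intro sum.cong) (auto simp: \<mu>)
      also have "\<dots> = (\<Sum>j<N. (\<Sum>i<p. A j $$ (i, i)) * indicat_real B (x j))"
        by (subst sum.swap) (simp add: sum_distrib_right)
      finally show "ennreal (\<Sum>i<p. \<mu> B $$ (i, i)) = 
        ennreal (\<Sum>j<N. (\<Sum>i<p. A j $$ (i, i)) * indicat_real B (x j))" by simp
    qed
    then show ?thesis
      using nn by (auto intro!: discrete_measure_integrable borel_measurable_continuous_onI continuous_intros)
  qed
  ultimately show ?thesis by (simp add: representing_measure_def)
qed

section \<open>Minimal representing measures\<close>

lemma sym_linear_operator_coeff_sum:
  assumes L: "sym_linear_operator p d L" and q: "degree q \<le> d" and ab: "a < p" "b < p"
  shows "L q $$ (a, b) = (\<Sum>m\<le>d. coeff q m * moment L m $$ (a, b))"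
proof -
  have carr: "L q \<in> carrier_mat p p" if "degree q \<le> d" for q
    using L that by (auto simp: sym_linear_operator_def sym_mats_def)
  have add: "L (q + r) $$ (a, b) = L q $$ (a, b) + L r $$ (a, b)"
    if "degree q \<le> d" "degree r \<le> d" for q r
    using L that carr[OF that(1)] carr[OF that(2)] ab by (simp add: sym_linear_operator_def)
  have smult: "L (Polynomial.smult c q) $$ (a, b) = c * L q $$ (a, b)" if "degree q \<le> d" for c q
    using L that carr[OF that] ab by (simp add: sym_linear_operator_def)
  have sum: "L (\<Sum>m\<in>K. Polynomial.monom (coeff q m) m) $$ (a, b) = (\<Sum>m\<in>K. coeff q m * moment L m $$ (a, b))"
    if "finite K" "K \<subseteq> {..d}" for K
    using that
  proof (induction K rule: finite_induct)
    case empty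
    show ?case using smult[of 0 0] by simp
  next
    case (insert m K)
    have m: "degree (Polynomial.monom (1 :: real) m) \<le> d"
      using insert.prems by (simp add: degree_monom_eq)
    have mono: "L (Polynomial.monom (coeff q m) m) $$ (a, b) = coeff q m * moment L m $$ (a, b)"
      using smult[OF m, of "coeff q m"] by (simp add: smult_monom moment_def)
    have deg: "degree (Polynomial.monom (coeff q i) i) \<le> d" if "i \<le> d" for i
      using that degree_monom_le order_trans by blast
    have "L (\<Sum>i\<in>insert m K. Polynomial.monom (coeff q i) i) $$ (a, b) =
      L (Polynomial.monom (coeff q m) m) $$ (a, b) + L (\<Sum>i\<in>K. Polynomial.monom (coeff q i) i) $$ (a, b)"
      using insert deg by (simp add: add degree_sum_le subset_iff)
    with insert mono show ?case by simp
  qed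
  have "q = (\<Sum>m\<le>d. Polynomial.monom (coeff q m) m)"
    using poly_as_sum_of_monoms'[OF q] by simp
  then show ?thesis using sum[of "{..d}"] by simp
qed

lemma atomic_representing_measure_iff_moments:
  assumes L: "sym_linear_operator p d L" and at: "atomic_form p \<mu> N A x"
  shows "representing_measure p d L \<mu> \<longleftrightarrow>
    (\<forall>m\<le>d. \<forall>a<p. \<forall>b<p. moment L m $$ (a, b) = (\<Sum>j<N. A j $$ (a, b) * x j ^ m))"
  unfolding atomic_representing_measure_iff[OF at]
proof (intro iffI allI impI)
  fix m a b
  assume *: "\<forall>q. degree q \<le> d \<longrightarrow> L q = Matrix.mat p p (\<lambda>(a, b). \<Sum>j<N. A j $$ (a, b) * poly q (x j))"
    and "m \<le> d" "a < p" "b < p"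
  then show "moment L m $$ (a, b) = (\<Sum>j<N. A j $$ (a, b) * x j ^ m)"
    using spec[OF *, of "Polynomial.monom 1 m"]
    by (simp add: moment_def degree_monom_eq poly_monom)
next
  fix q :: "real poly"
  assume *: "\<forall>m\<le>d. \<forall>a<p. \<forall>b<p. moment L m $$ (a, b) = (\<Sum>j<N. A j $$ (a, b) * x j ^ m)"
    and q: "degree q \<le> d"
  have "L q \<in> carrier_mat p p" using L q by (auto simp: sym_linear_operator_def sym_mats_def)
  moreover have "L q $$ (a, b) = (\<Sum>j<N. A j $$ (a, b) * poly q (x j))" if "a < p" "b < p" for a b
  proof -
    have pq: "poly q y = (\<Sum>m\<le>d. coeff q m * y ^ m)" for y
      by (subst poly_as_sum_of_monoms'[OF q, symmetric]) (simp add: poly_sum poly_monom)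
    have "L q $$ (a, b) = (\<Sum>m\<le>d. coeff q m * (\<Sum>j<N. A j $$ (a, b) * x j ^ m))"
      using * that by (simp add: sym_linear_operator_coeff_sum[OF L q that])
    also have "\<dots> = (\<Sum>j<N. A j $$ (a, b) * poly q (x j))"
      unfolding pq sum_distrib_left by (subst sum.swap) (simp add: mult_ac)
    finally show ?thesis .
  qed
  ultimately show "L q = Matrix.mat p p (\<lambda>(a, b). \<Sum>j<N. A j $$ (a, b) * poly q (x j))"
    by (intro eq_matI) auto
qed

text \<open>
  Translates between flat indices of the block matrix and pairs of a block number and a position
  in the block.
\<close>

lemma sum_blocks:
  fixes f :: "nat \<times> nat \<Rightarrow> real"
  assumes "p > 0"
  shows "(\<Sum>r<(n + 1) * p. f (r div p, r mod p)) = (\<Sum>\<alpha>\<in>{..n} \<times> {..<p}. f \<alpha>)"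
proof (rule sum.reindex_bij_witness[of _ "\<lambda>(i, a). i * p + a" "\<lambda>r. (r div p, r mod p)"], goal_cases)
  case (2 r)
  then have "r div p < n + 1" using less_mult_imp_div_less[of r "n + 1" p] by simp
  with assms show ?case by auto
next
  case (4 \<alpha>)
  then obtain i a where \<alpha>: "\<alpha> = (i, a)" "i \<le> n" "a < p" by auto
  have "i * p + a < (i + 1) * p" using \<alpha> by simp
  also have "\<dots> \<le> (n + 1) * p" using \<alpha> by (intro mult_right_mono) auto
  finally show ?case using \<alpha> by simp
qed (use assms in auto)

lemma moment_matrix_posdef_on:
  assumes "p > 0" and pd: "pos_def ((n + 1) * p) (moment_matrix p n L)"
  shows "posdef_on ({..n} \<times> {..<p}) (hankel (\<lambda>m a b. moment L m $$ (a, b)))"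
  unfolding posdef_on_def
proof (intro allI impI)
  fix u :: "nat \<times> nat \<Rightarrow> real"
  assume "\<exists>\<alpha>\<in>{..n} \<times> {..<p}. u \<alpha> \<noteq> 0"
  then obtain i a where ia: "i \<le> n" "a < p" "u (i, a) \<noteq> 0" by auto
  define M where "M = moment_matrix p n L"
  define N where "N = (n + 1) * p"
  have M: "M \<in> carrier_mat N N" by (simp add: M_def N_def moment_matrix_def)
  define v where "v = Matrix.vec N (\<lambda>r. u (r div p, r mod p))"
  have v: "v \<in> carrier_vec N" by (simp add: v_def)
  have "i * p + a < (i + 1) * p" using ia by simp
  also have "\<dots> \<le> N" unfolding N_def using ia by (intro mult_right_mono) auto
  finally have "v $ (i * p + a) \<noteq> 0\<^sub>v N $ (i * p + a)" using ia by (simp add: v_def)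
  then have "v \<noteq> 0\<^sub>v N" by auto
  with pd v have "0 < scalar_prod v (M *\<^sub>v v)" by (auto simp: pos_def_def M_def N_def)
  also have "\<dots> = (\<Sum>r<N. \<Sum>s<N. v $ r * M $$ (r, s) * v $ s)"
    by (rule quadratic_form_sum[OF M v])
  also have "\<dots> = (\<Sum>r<N. u (r div p, r mod p) * (\<Sum>s<N.
      hankel (\<lambda>m a b. moment L m $$ (a, b)) (r div p, r mod p) (s div p, s mod p) * u (s div p, s mod p)))"
    unfolding sum_distrib_left
    by (intro sum.cong refl) (simp add: v_def M_def N_def moment_matrix_def hankel_def mult.assoc)
  also have "\<dots> = bform ({..n} \<times> {..<p}) (hankel (\<lambda>m a b. moment L m $$ (a, b))) u u"
    unfolding N_def bform_def
    by (simp only: sum_blocks[OF assms(1), of "\<lambda>\<beta>. hankel (\<lambda>m a b. moment L m $$ (a, b)) \<alpha> \<beta> * u \<beta>" for \<alpha>]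
       sum_blocks[OF assms(1), of "\<lambda>\<alpha>. u \<alpha> * (\<Sum>\<beta>\<in>{..n} \<times> {..<p}. hankel (\<lambda>m a b. moment L m $$ (a, b)) \<alpha> \<beta> * u \<beta>)"])
  finally show "0 < bform ({..n} \<times> {..<p}) (hankel (\<lambda>m a b. moment L m $$ (a, b))) u u" .
qed

text \<open>
  This is the lower bound that makes a measure of total rank \<open>(n + 1) p\<close> minimal:
  entry \<open>((i, a), (j, b))\<close> of the moment matrix is the sum over the atoms
  \<open>y\<close> of \<open>y\<^sup>i y\<^sup>j\<close> times entry \<open>(a, b)\<close> of
  the mass at \<open>y\<close>.
\<close>

lemma atomic_representing_measure_card_le:
  assumes "p > 0" and L: "sym_linear_operator p (2 * n) L"
    and pd: "pos_def ((n + 1) * p) (moment_matrix p n L)"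
    and rep: "representing_measure p (2 * n) L \<mu>" and at: "atomic_form p \<mu> N A x"
  shows "(n + 1) * p \<le> (\<Sum>j<N. mat_rank p (A j))"
proof -
  have "card ({..n} \<times> {..<p}) \<le> (\<Sum>j<N. mat_rank p (A j))"
  proof (rule posdef_card_le_rank_sum[OF _ moment_matrix_posdef_on[OF assms(1) pd],
        where v = "\<lambda>j (i, a). x j ^ i" and e = snd], goal_cases)
    case (2 j)
    then show ?case using at by (auto simp: atomic_form_def pos_semidef_def sym_mats_def)
  next
    case (3 \<alpha> \<beta>)
    then show ?case
      using rep[unfolded atomic_representing_measure_iff_moments[OF L at]]
      by (auto simp: hankel_def power_add mult_ac)
  qed auto
  then show ?thesis by (simp add: card_cartesian_product)
qed

lemma gram_pos_semidef:
  assumes "finite K"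
  shows "pos_semidef p (Matrix.mat p p (\<lambda>(a, b). \<Sum>k\<in>K. c k a * c k b))" (is "pos_semidef p ?A")
proof -
  have "?A \<in> sym_mats p" by (auto simp: sym_mats_def mult.commute intro!: eq_matI)
  moreover have "scalar_prod v (?A *\<^sub>v v) \<ge> 0" if v: "v \<in> carrier_vec p" for v
  proof -
    have "scalar_prod v (?A *\<^sub>v v) = (\<Sum>a<p. \<Sum>b<p. \<Sum>k\<in>K. (v $ a * c k a) * (v $ b * c k b))"
      using v by (subst quadratic_form_sum[of _ p])
        (auto simp: sum_distrib_left sum_distrib_right mult_ac intro!: sum.cong)
    also have "\<dots> = (\<Sum>k\<in>K. \<Sum>a<p. \<Sum>b<p. (v $ a * c k a) * (v $ b * c k b))"
      by (subst (2) sum.swap) (subst sum.swap, intro sum.cong refl)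
    also have "\<dots> = (\<Sum>k\<in>K. (\<Sum>a<p. v $ a * c k a)\<^sup>2)"
      by (simp add: power2_eq_square sum_product)
    also have "\<dots> \<ge> 0" by (intro sum_nonneg) auto
    finally show ?thesis .
  qed
  ultimately show ?thesis by (simp add: pos_semidef_def)
qed

theorem corollary1p2:
  fixes n p :: nat and L :: "real poly \<Rightarrow> real mat" and t :: real
  assumes "n \<ge> 1" and "p \<ge> 1"
    and "sym_linear_operator p (2 * n) L"
    and "pos_def ((n + 1) * p) (moment_matrix p n L)"
  shows "\<exists>\<mu>. minimal_representing_measure p (2 * n) L \<mu> \<and> multiplicity_at p \<mu> t = 0"
proof -
  note L = assms(3) and pd = assms(4)
  have p: "p > 0" using assms(2) by simp
  define I where "I = {..n} \<times> {..<p}"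
  have fin: "finite I" and cardI: "card I = (n + 1) * p"
    by (auto simp: I_def card_cartesian_product)
  define S where "S = (\<lambda>m a b. moment L m $$ (a, b))"
  have symS: "S m a b = S m b a" if "m \<le> 2 * n" "a < p" "b < p" for m a b
  proof -
    have "moment L m \<in> sym_mats p"
      using L that by (auto simp: sym_linear_operator_def moment_def degree_monom_eq)
    then show ?thesis using that unfolding S_def sym_mats_def
      by (metis (mono_tags, lifting) carrier_matD index_transpose_mat(1) mem_Collect_eq)
  qed
  have "posdef_on I (hankel S)"
    unfolding S_def I_def by (rule moment_matrix_posdef_on[OF p pd])
  then have "\<exists>c l. (\<forall>k\<in>I. l k \<noteq> t) \<and> (\<forall>k\<in>I. \<exists>a<p. c k a \<noteq> 0) \<and>
    (\<forall>m\<le>2 * n. \<forall>a<p. \<forall>b<p. S m a b = (\<Sum>k\<in>I. l k ^ m * c k a * c k b))"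
    unfolding I_def by (intro quadrature_avoiding_point) (auto intro: symS)
  then obtain c l where lt: "\<And>k. k \<in> I \<Longrightarrow> l k \<noteq> t"
    and cnz: "\<And>k. k \<in> I \<Longrightarrow> \<exists>a<p. c k a \<noteq> 0"
    and quad: "\<And>m a b. m \<le> 2 * n \<Longrightarrow> a < p \<Longrightarrow> b < p \<Longrightarrow>
      S m a b = (\<Sum>k\<in>I. l k ^ m * c k a * c k b)"
    by blast
  define N where "N = card (l ` I)"
  obtain x where x: "bij_betw x {..<N} (l ` I)"
    using ex_bij_betw_nat_finite[of "l ` I"] fin by (auto simp: N_def atLeast0LessThan)
  \<comment> \<open>The values of \<open>l\<close> may coincide; the masses at equal nodes form one atom.\<close>
  define K where "K = (\<lambda>y. {k \<in> I. l k = y})"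
  have finK: "finite (K y)" for y using fin by (simp add: K_def)
  define A where "A = (\<lambda>j. Matrix.mat p p (\<lambda>(a, b). \<Sum>k\<in>K (x j). c k a * c k b))"
  define \<mu> where "\<mu> = (\<lambda>B. Matrix.mat p p (\<lambda>(a, b). \<Sum>j<N. A j $$ (a, b) * indicat_real B (x j)))"
  have xl: "x j \<in> l ` I" if "j < N" for j using x that by (auto simp: bij_betw_def)
  have fibre: "(\<Sum>k\<in>I. h k) = (\<Sum>j<N. \<Sum>k\<in>K (x j). h k)" for h :: "nat \<times> nat \<Rightarrow> 'b :: comm_monoid_add"
    unfolding sum.image_gen[OF fin, of h l] K_def by (rule sum.reindex_bij_betw[OF x, symmetric])
  have "A j \<noteq> 0\<^sub>m p p" if jN: "j < N" for j
  proof -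
    obtain k where k: "k \<in> K (x j)" using xl[OF jN] by (auto simp: K_def)
    then have "k \<in> I" by (simp add: K_def)
    then obtain a where a: "a < p" "c k a \<noteq> 0" using cnz by blast
    have "0 < (\<Sum>k\<in>K (x j). c k a * c k a)"
      using k a finK by (intro sum_pos2[of _ k]) (auto simp: zero_less_mult_iff linorder_neq_iff)
    also have "\<dots> = A j $$ (a, a)" using a by (simp add: A_def)
    finally show ?thesis using a by auto
  qed
  then have at: "atomic_form p \<mu> N A x"
    using x gram_pos_semidef[OF finK] by (auto simp: atomic_form_def bij_betw_def A_def \<mu>_def)
  have rep: "representing_measure p (2 * n) L \<mu>"
    unfolding atomic_representing_measure_iff_moments[OF L at]
  proof (intro allI impI)
    fix m a b assume mab: "m \<le> 2 * n" "a < p" "b < p"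
    have "moment L m $$ (a, b) = (\<Sum>j<N. \<Sum>k\<in>K (x j). l k ^ m * c k a * c k b)"
      using quad[OF mab] by (simp add: S_def fibre)
    also have "\<dots> = (\<Sum>j<N. A j $$ (a, b) * x j ^ m)"
    proof (intro sum.cong refl)
      fix j
      have "A j $$ (a, b) * x j ^ m = (\<Sum>k\<in>K (x j). c k a * c k b * x j ^ m)"
        using mab by (simp add: A_def sum_distrib_right)
      also have "\<dots> = (\<Sum>k\<in>K (x j). l k ^ m * c k a * c k b)"
        by (intro sum.cong) (auto simp: K_def)
      finally show "(\<Sum>k\<in>K (x j). l k ^ m * c k a * c k b) = A j $$ (a, b) * x j ^ m" by simp
    qed
    finally show "moment L m $$ (a, b) = (\<Sum>j<N. A j $$ (a, b) * x j ^ m)" .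
  qed
  have "(\<Sum>j<N. mat_rank p (A j)) \<le> (\<Sum>j<N. card (K (x j)))"
    by (intro sum_mono rank_le_card_products[of _ _ p, OF _ finK, where c = c and d = c]) (auto simp: A_def)
  also have "\<dots> = (n + 1) * p"
    using fibre[of "\<lambda>_. 1 :: nat"] by (simp add: cardI)
  finally have "minimal_representing_measure p (2 * n) L \<mu>"
    unfolding minimal_representing_measure_def
    using rep at atomic_representing_measure_card_le[OF p L pd] by (meson order_trans)
  moreover have "x j \<noteq> t" if "j < N" for j using xl[OF that] lt by (metis imageE)
  then have "indicat_real {t} (x j) = 0" if "j < N" for j using that by auto
  then have "\<mu> {t} = 0\<^sub>m p p"
    unfolding \<mu>_def by (intro eq_matI) (simp_all del: indicator_simps)
  then have "multiplicity_at p \<mu> t = 0"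
    unfolding multiplicity_at_def
    using rank_le_card_products[of "0\<^sub>m p p" p p "{}"] by simp
  ultimately show ?thesis by blast
qed

end
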